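(* For each locally compact contraction group $(G,\alpha)$, we have: (a) There exists a composition series $\{e\}=G_0\lhd G_1\lhd\cdots\lhd G_n=G$ of contraction groups for $(G,\alpha)$. (b) (Zassenhaus Lemma) Any two series of contraction groups for $(G,\alpha)$ admit refinements which are isomorphic as series of contraction groups. (c) (Jordan–Hölder Theorem) Every series of contraction groups for $(G,\alpha)$ can be refined to a composition series of contraction groups. Moreover, any two composition series of contraction groups for $(G,\alpha)$ are isomorphic as series of contraction groups.
   Context: A locally compact contraction group is a pair $(G,\alpha)$ where $G$ is a (Hausdorff) locally compact group and $\alpha\colon G\to G$ is a bicontinuous automorphism with $\alpha^n(x)\to e$ as $n\to\infty$ for each $x\in G$. An isomorphism $(G,\alpha_G)\to(H,\alpha_H)$ of contraction groups is an isomorphism of topological groups $\phi$ with $\alpha_H\circ\phi=\phi\circ\alpha_G$. A subgroup $N$ is $\alpha$-stable if $\alpha(N)=N$. $(G,\alpha)$ is simple if $G\neq\{e\}$ and $G$ has no $\alpha$-stable closed normal subgroups except for $\{e\}$ and $G$. A series of contraction groups for $(G,\alpha)$ is a series $\{e\}=G_0\lhd G_1\lhd\cdots\lhd G_n=G$ (each $G_{j-1}$ normal in $G_j$) such that every $G_j$ is a closed $\alpha$-stable subgroup of $G$. The quotients $G_j/G_{j-1}$ are endowed with the contractive automorphism $\overline{\alpha}_j\colon xG_{j-1}\mapsto\alpha(x)G_{j-1}$. The series is a composition series of contraction groups if $(G_j/G_{j-1},\overline{\alpha}_j)$ is a simple contraction group for all $j\in\{1,\ldots,n\}$. A series $\{e\}=G_0\lhd\cdots\lhd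 G_n=G$ is a refinement of a series $\{e\}=H_0\lhd\cdots\lhd H_m=G$ if $\{H_0,\ldots,H_m\}\subseteq\{G_0,\ldots,G_n\}$. The two series are isomorphic if $m=n$ and there is a permutation $\pi$ of $\{1,\ldots,n\}$ such that $G_j/G_{j-1}\cong H_{\pi(j)}/H_{\pi(j)-1}$ as contraction groups for all $j\in\{1,\ldots,n\}$. *)

theory Defs
  imports "HOL-Analysis.Analysis" "HOL-Algebra.Coset"
begin

section \<open>Quotient topologies\<close>

definition quotient_topology :: "'a topology \<Rightarrow> ('a \<Rightarrow> 'b) \<Rightarrow> 'b topology"
  where "quotient_topology X f =
    topology (\<lambda>U. U \<subseteq> f ` topspace X \<and> openin X {x \<in> topspace X. f x \<in> U})"

lemma openin_quotient_topology:
  "openin (quotient_topology X f) U \<longleftrightarrow>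
     U \<subseteq> f ` topspace X \<and> openin X {x \<in> topspace X. f x \<in> U}"
proof -
  have "istopology (\<lambda>U. U \<subseteq> f ` topspace X \<and> openin X {x \<in> topspace X. f x \<in> U})"
    unfolding istopology_def
  proof (intro conjI allI impI)
    fix S T
    assume S: "S \<subseteq> f ` topspace X \<and> openin X {x \<in> topspace X. f x \<in> S}"
      and T: "T \<subseteq> f ` topspace X \<and> openin X {x \<in> topspace X. f x \<in> T}"
    have "{x \<in> topspace X. f x \<in> S \<inter> T} =
        {x \<in> topspace X. f x \<in> S} \<inter> {x \<in> topspace X. f x \<in> T}" by auto
    then show "openin X {x \<in> topspace X. f x \<in> S \<inter> T}" using S T by auto
    show "S \<inter> T \<subseteq> f ` topspace X" using S by auto
  next
    fix \<K>
    assume K: "\<forall>K\<in>\<K>. K \<subseteq> f ` topspace X \<and> openin X {x \<in> topspace X. f x \<in> K}"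
    have "{x \<in> topspace X. f x \<in> \<Union>\<K>} = (\<Union>K\<in>\<K>. {x \<in> topspace X. f x \<in> K})" by auto
    then show "openin X {x \<in> topspace X. f x \<in> \<Union>\<K>}" using K by auto
    show "\<Union>\<K> \<subseteq> f ` topspace X" using K by auto
  qed
  then show ?thesis by (simp add: quotient_topology_def)
qed

lemma topspace_quotient_topology: "topspace (quotient_topology X f) = f ` topspace X"
proof
  show "topspace (quotient_topology X f) \<subseteq> f ` topspace X"
    using openin_quotient_topology[of X f "topspace (quotient_topology X f)"] by simp
  have "{x \<in> topspace X. f x \<in> f ` topspace X} = topspace X" by auto
  then have "openin (quotient_topology X f) (f ` topspace X)"
    by (simp add: openin_quotient_topology)
  then show "f ` topspace X \<subseteq> topspace (quotient_topology X f)"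
    by (rule openin_subset)
qed

lemma quotient_map_quotient_topology: "quotient_map X (quotient_topology X f) f"
  by (simp add: quotient_map_def topspace_quotient_topology openin_quotient_topology)

section \<open>Locally compact contraction groups\<close>

locale topological_group = group G for G (structure) +
  fixes T
  assumes topspace_eq: "topspace T = carrier G"
    and continuous_mult: "continuous_map (prod_topology T T) T (\<lambda>(x, y). x \<otimes> y)"
    and continuous_inv: "continuous_map T T (m_inv G)"

locale lc_contraction_group = topological_group +
  fixes \<alpha>
  assumes Hausdorff: "Hausdorff_space T"
    and locally_compact: "locally_compact_space T"
    and automorphism: "\<alpha> \<in> iso G G"
    and bicontinuous: "homeomorphic_map T T \<alpha>"
    and contractive: "\<And>x. x \<in> carrier G \<Longrightarrow> limitin T (\<lambda>n. (\<alpha> ^^ n) x) \<one> sequentially"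

definition contraction_group_isomorphic ::
  "('a, 'c) monoid_scheme \<Rightarrow> 'a topology \<Rightarrow> ('a \<Rightarrow> 'a) \<Rightarrow>
   ('b, 'd) monoid_scheme \<Rightarrow> 'b topology \<Rightarrow> ('b \<Rightarrow> 'b) \<Rightarrow> bool"
  where "contraction_group_isomorphic G T \<alpha> H U \<beta> \<longleftrightarrow>
    (\<exists>\<phi>. \<phi> \<in> iso G H \<and> homeomorphic_map T U \<phi> \<and> (\<forall>x \<in> carrier G. \<beta> (\<phi> x) = \<phi> (\<alpha> x)))"

definition simple_contraction_group ::
  "('a, 'c) monoid_scheme \<Rightarrow> 'a topology \<Rightarrow> ('a \<Rightarrow> 'a) \<Rightarrow> bool"
  where "simple_contraction_group G T \<alpha> \<longleftrightarrow>
    lc_contraction_group G T \<alpha> \<and> carrier G \<noteq> {\<one>\<^bsub>G\<^esub>} \<and>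
    (\<forall>N. N \<lhd> G \<and> closedin T N \<and> \<alpha> ` N = N \<longrightarrow> N = {\<one>\<^bsub>G\<^esub>} \<or> N = carrier G)"

section \<open>Subquotients\<close>

text \<open>For \<open>N \<lhd> H \<le> G\<close>, the factor \<open>H / N\<close> with the quotient of the subspace topology
  and the induced automorphism. The latter sends a coset to its image under \<open>\<alpha>\<close>, which is
  the coset of the image of any representative when \<open>N\<close> is \<open>\<alpha>\<close>-stable
  (see \<open>factor_aut_rcoset\<close>).\<close>

definition factor_group :: "('a, 'c) monoid_scheme \<Rightarrow> 'a set \<Rightarrow> 'a set \<Rightarrow> 'a set monoid"
  where "factor_group G H N = (G\<lparr>carrier := H\<rparr>) Mod N"

definition factor_topology ::
  "('a, 'c) monoid_scheme \<Rightarrow> 'a topology \<Rightarrow> 'a set \<Rightarrow> 'a set \<Rightarrow> 'a set topology"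
  where "factor_topology G T H N = quotient_topology (subtopology T H) (\<lambda>x. N #>\<^bsub>G\<^esub> x)"

definition factor_aut :: "('a \<Rightarrow> 'a) \<Rightarrow> 'a set \<Rightarrow> 'a set"
  where "factor_aut \<alpha> C = \<alpha> ` C"

lemma factor_aut_rcoset:
  assumes "\<alpha> \<in> hom G G" "N \<subseteq> carrier G" "\<alpha> ` N = N" "x \<in> carrier G"
  shows "factor_aut \<alpha> (N #>\<^bsub>G\<^esub> x) = N #>\<^bsub>G\<^esub> \<alpha> x"
proof -
  have "\<alpha> ` (N #>\<^bsub>G\<^esub> x) = (\<lambda>h. \<alpha> (h \<otimes>\<^bsub>G\<^esub> x)) ` N"
    by (auto simp: r_coset_def)
  also have "\<dots> = (\<lambda>h. \<alpha> h \<otimes>\<^bsub>G\<^esub> \<alpha> x) ` N"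
    using assms by (intro image_cong) (auto simp: hom_def)
  also have "\<dots> = (\<lambda>h. h \<otimes>\<^bsub>G\<^esub> \<alpha> x) ` (\<alpha> ` N)"
    by (simp add: image_image)
  also have "\<dots> = N #>\<^bsub>G\<^esub> \<alpha> x"
    using assms by (auto simp: r_coset_def)
  finally show ?thesis by (simp add: factor_aut_def)
qed

lemma topspace_factor_topology:
  assumes "H \<subseteq> topspace T"
  shows "topspace (factor_topology G T H N) = carrier (factor_group G H N)"
proof -
  have "topspace (subtopology T H) = H"
    using assms by (simp add: topspace_subtopology Int_absorb1)
  then show ?thesis
    by (simp add: factor_topology_def factor_group_def topspace_quotient_topology
        carrier_FactGroup r_coset_def)
qed

section \<open>Series of contraction groups\<close>

text \<open>A series of length \<open>n\<close> is a function \<open>S :: nat \<Rightarrow> 'a set\<close> of which only the values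
  at \<open>0, \<dots>, n\<close> matter. Repetitions are allowed.\<close>

definition contraction_series ::
  "('a, 'c) monoid_scheme \<Rightarrow> 'a topology \<Rightarrow> ('a \<Rightarrow> 'a) \<Rightarrow> nat \<Rightarrow> (nat \<Rightarrow> 'a set) \<Rightarrow> bool"
  where "contraction_series G T \<alpha> n S \<longleftrightarrow>
    S 0 = {\<one>\<^bsub>G\<^esub>} \<and> S n = carrier G \<and>
    (\<forall>j\<in>{0..n}. subgroup (S j) G \<and> closedin T (S j) \<and> \<alpha> ` S j = S j) \<and>
    (\<forall>j\<in>{1..n}. S (j - 1) \<lhd> G\<lparr>carrier := S j\<rparr>)"

definition contraction_composition_series ::
  "('a, 'c) monoid_scheme \<Rightarrow> 'a topology \<Rightarrow> ('a \<Rightarrow> 'a) \<Rightarrow> nat \<Rightarrow> (nat \<Rightarrow> 'a set) \<Rightarrow> bool"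
  where "contraction_composition_series G T \<alpha> n S \<longleftrightarrow>
    contraction_series G T \<alpha> n S \<and>
    (\<forall>j\<in>{1..n}. simple_contraction_group
       (factor_group G (S j) (S (j - 1))) (factor_topology G T (S j) (S (j - 1)))
       (factor_aut \<alpha>))"

definition series_refines :: "nat \<Rightarrow> (nat \<Rightarrow> 'a set) \<Rightarrow> nat \<Rightarrow> (nat \<Rightarrow> 'a set) \<Rightarrow> bool"
  where "series_refines n S m R \<longleftrightarrow> R ` {0..m} \<subseteq> S ` {0..n}"

definition series_isomorphic ::
  "('a, 'c) monoid_scheme \<Rightarrow> 'a topology \<Rightarrow> ('a \<Rightarrow> 'a) \<Rightarrow>
   nat \<Rightarrow> (nat \<Rightarrow> 'a set) \<Rightarrow> nat \<Rightarrow> (nat \<Rightarrow> 'a set) \<Rightarrow> bool"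
  where "series_isomorphic G T \<alpha> n S m R \<longleftrightarrow>
    m = n \<and>
    (\<exists>\<pi>. \<pi> permutes {1..n} \<and>
      (\<forall>j\<in>{1..n}. contraction_group_isomorphic
         (factor_group G (S j) (S (j - 1))) (factor_topology G T (S j) (S (j - 1)))
         (factor_aut \<alpha>)
         (factor_group G (R (\<pi> j)) (R (\<pi> j - 1))) (factor_topology G T (R (\<pi> j)) (R (\<pi> j - 1)))
         (factor_aut \<alpha>)))"

end

theory Submission
  imports Defs "HOL-Algebra.Zassenhaus"
begin

text \<open>
  By Baire category, \<open>\<alpha>\<close> contracts compact sets uniformly. Let \<open>V\<close> be a compact neighbourhood
  of the identity and \<open>H \<subset> L\<close> closed \<open>\<alpha>\<close>-stable subgroups. A point of \<open>L - H\<close>, rescaled by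
  powers of \<open>\<alpha>\<close> and corrected by an element of \<open>H\<close>, lands in \<open>L \<inter> V\<close> but outside \<open>H \<alpha>(V)\<close>.
  In a strictly increasing chain the points so obtained are uniformly separated, and as \<open>V\<close> is
  compact, this bounds the length of the chain. Hence a strict refinement of maximal length
  exists, and it is a composition series.

  The algebraic Zassenhaus isomorphisms are topological because the same rescaling shows, for
  closed \<open>\<alpha>\<close>-stable subgroups \<open>H\<close> and \<open>N\<close>, that \<open>(H \<inter> O) N\<close> is a neighbourhood of the
  identity in \<open>H N\<close> for each neighbourhood \<open>O\<close> of the identity, and that \<open>H N\<close> is closed: a
  limit point is first contracted into a neighbourhood in which \<open>H N\<close> agrees with \<open>C N\<close>,
  where \<open>C\<close> is compact.
\<close>

text \<open>The obstacle is topological. In a general locally compact group a product of closed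
  subgroups need not be closed (take the integers and their multiples by the square root of 2 in the
  reals), and the continuous bijection from P/(P \<inter> M) to PM/M need not be open. Both failures
  come from products hn near the identity whose factors are far from it. Contraction excludes this:
  follow the orbit of h under \<alpha> to the moment when it enters a fixed compact set modulo H
  \<inter> N; at that moment the orbit of hn would meet a closed set away from the identity, which
  equicontraction forbids for hn near the identity. Uniqueness of composition series is read off
  from the array of Zassenhaus factors, not from isomorphic refinements, so no repeated terms have
  to be removed: simplicity leaves exactly one nontrivial factor in each row and column, and this is
  a bijection of the index sets.\<close>

lemma (in group) inv_cancel_left:
  assumes "x \<in> carrier G" "y \<in> carrier G"
  shows "x \<otimes> (inv x \<otimes> y) = y" "inv x \<otimes> (x \<otimes> y) = y"
  using assms by (simp_all add: m_assoc[symmetric])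

section \<open>Topological groups: translates, small neighbourhoods, products with compact
  sets\<close>

context topological_group
begin

lemma openin_carrier: "openin T U \<Longrightarrow> U \<subseteq> carrier G"
  using openin_subset topspace_eq by blast

lemma continuous_map_mult:
  assumes "continuous_map X T f" "continuous_map X T g"
  shows "continuous_map X T (\<lambda>x. f x \<otimes> g x)"
  using continuous_map_compose[OF continuous_map_pairedI[OF assms] continuous_mult]
  by (simp add: o_def)

lemma continuous_map_inverse:
  assumes "continuous_map X T f"
  shows "continuous_map X T (\<lambda>x. inv (f x))"
  using continuous_map_compose[OF assms continuous_inv] by (simp add: o_def)

lemma continuous_map_left_translation:
  "x \<in> carrier G \<Longrightarrow> continuous_map T T (\<lambda>y. x \<otimes> y)"
  by (intro continuous_map_mult) (auto simp: topspace_eq)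

lemma continuous_map_right_translation:
  "x \<in> carrier G \<Longrightarrow> continuous_map T T (\<lambda>y. y \<otimes> x)"
  by (intro continuous_map_mult) (auto simp: topspace_eq)

text \<open>Translates are written as preimages, here x^-1 U, so that openness is just continuity of
  a translation.\<close>

lemma openin_left_translate:
  assumes "openin T U" "x \<in> carrier G"
  shows "openin T {y \<in> carrier G. x \<otimes> y \<in> U}"
  using openin_continuous_map_preimage[OF continuous_map_left_translation assms(1)] assms(2)
  by (simp add: topspace_eq)

lemma openin_right_translate:
  assumes "openin T U" "x \<in> carrier G"
  shows "openin T {y \<in> carrier G. y \<otimes> x \<in> U}"
  using openin_continuous_map_preimage[OF continuous_map_right_translation assms(1)] assms(2)
  by (simp add: topspace_eq)

lemma neighbourhood_mult:
  assumes "openin T W" "\<one> \<in> W"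
  obtains V where "openin T V" "\<one> \<in> V" "\<And>a b. a \<in> V \<Longrightarrow> b \<in> V \<Longrightarrow> a \<otimes> b \<in> W"
proof -
  let ?P = "{p \<in> topspace (prod_topology T T). (\<lambda>(x, y). x \<otimes> y) p \<in> W}"
  have "openin (prod_topology T T) ?P"
    by (rule openin_continuous_map_preimage[OF continuous_mult assms(1)])
  moreover have "(\<one>, \<one>) \<in> ?P"
    using assms by (simp add: topspace_eq)
  ultimately have "\<exists>A B. openin T A \<and> openin T B \<and> \<one> \<in> A \<and> \<one> \<in> B \<and> A \<times> B \<subseteq> ?P"
    by (rule openin_prod_topology_alt[THEN iffD1, rule_format])
  then obtain A B where AB: "openin T A" "openin T B" "\<one> \<in> A" "\<one> \<in> B" "A \<times> B \<subseteq> ?P"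
    by (elim exE conjE)
  show thesis
  proof (rule that[of "A \<inter> B"])
    show "openin T (A \<inter> B)" "\<one> \<in> A \<inter> B" using AB by auto
    fix a b assume "a \<in> A \<inter> B" "b \<in> A \<inter> B"
    then have "(a, b) \<in> ?P" using AB by blast
    then show "a \<otimes> b \<in> W" by simp
  qed
qed

lemma neighbourhood_inv_mult:
  assumes "openin T W" "\<one> \<in> W"
  obtains V where "openin T V" "\<one> \<in> V" "\<And>a b. a \<in> V \<Longrightarrow> b \<in> V \<Longrightarrow> inv a \<otimes> b \<in> W"
proof -
  obtain U where U: "openin T U" "\<one> \<in> U" "\<And>a b. a \<in> U \<Longrightarrow> b \<in> U \<Longrightarrow> a \<otimes> b \<in> W"
    using neighbourhood_mult[OF assms] by metis
  let ?V = "U \<inter> {x \<in> topspace T. inv x \<in> U}"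
  show thesis
  proof (rule that[of ?V])
    show "openin T ?V"
      using openin_continuous_map_preimage[OF continuous_inv U(1)] U(1) by blast
    show "\<one> \<in> ?V" using U(2) by (simp add: topspace_eq)
  qed (use U(3) in auto)
qed

lemma compact_cover_translates:
  assumes K: "compactin T K" and U: "openin T U" "\<one> \<in> U"
  obtains F where "finite F" "F \<subseteq> K" "K \<subseteq> (\<Union>x\<in>F. {y \<in> carrier G. inv x \<otimes> y \<in> U})"
proof -
  have KG: "K \<subseteq> carrier G" using compactin_subset_topspace[OF K] topspace_eq by simp
  let ?t = "\<lambda>x. {y \<in> carrier G. inv x \<otimes> y \<in> U}"
  have "\<exists>\<F>. finite \<F> \<and> \<F> \<subseteq> ?t ` K \<and> K \<subseteq> \<Union>\<F>"
  proof (rule compactinD[OF K])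
    show "openin T W" if "W \<in> ?t ` K" for W
      using that KG openin_left_translate[OF U(1)] by auto
    show "K \<subseteq> \<Union> (?t ` K)"
    proof
      fix x assume "x \<in> K"
      then show "x \<in> \<Union> (?t ` K)"
        using KG U(2) by (intro UN_I[of x]) auto
    qed
  qed
  then obtain \<F> where "finite \<F>" "\<F> \<subseteq> ?t ` K" "K \<subseteq> \<Union>\<F>" by blast
  moreover from this obtain F where "F \<subseteq> K" "finite F" "\<F> = ?t ` F"
    by (meson finite_subset_image)
  ultimately show thesis
    using that[of F] by simp
qed

text \<open>KN is the image of the closed set of pairs (a, b) with a^-1 b in N under the projection
  from K x G to G, and projecting along a compact factor is a closed map.\<close>

lemma closedin_compact_mult_closed:
  assumes K: "compactin T K" and N: "closedin T N"
  shows "closedin T (K <#> N)"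
proof -
  have KG: "K \<subseteq> carrier G" using compactin_subset_topspace[OF K] topspace_eq by simp
  have NG: "N \<subseteq> carrier G" using closedin_subset[OF N] topspace_eq by simp
  let ?X = "prod_topology (subtopology T K) T"
  have c: "continuous_map ?X T (\<lambda>p. inv (fst p) \<otimes> snd p)"
    by (intro continuous_map_mult continuous_map_inverse continuous_map_into_fulltopology[OF continuous_map_fst]
       continuous_map_snd)
  have "closedin ?X {p \<in> topspace ?X. inv (fst p) \<otimes> snd p \<in> N}"
    by (rule closedin_continuous_map_preimage[OF c N])
  then have "closedin T (snd ` {p \<in> topspace ?X. inv (fst p) \<otimes> snd p \<in> N})"
    using closed_map_snd[OF compact_space_subtopology[OF K], of T] unfolding closed_map_def by blast
  moreover have "snd ` {p \<in> topspace ?X. inv (fst p) \<otimes> snd p \<in> N} = K <#> N" (is "?L = _")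
  proof
    show "?L \<subseteq> K <#> N"
    proof clarsimp
      fix a b assume ab: "a \<in> topspace T" "a \<in> K" "b \<in> topspace T" "inv a \<otimes> b \<in> N"
      then have "b = a \<otimes> (inv a \<otimes> b)" using KG topspace_eq by (simp add: m_assoc[symmetric])
      then show "b \<in> K <#> N" using ab unfolding set_mult_def by blast
    qed
    show "K <#> N \<subseteq> ?L"
    proof
      fix b assume "b \<in> K <#> N"
      then obtain a n where an: "a \<in> K" "n \<in> N" "b = a \<otimes> n" unfolding set_mult_def by blast
      then have "inv a \<otimes> b = n" "b \<in> carrier G" "a \<in> carrier G"
        using KG NG by (auto simp: m_assoc[symmetric] subset_iff)
      then show "b \<in> ?L" using an by (auto simp: topspace_eq intro!: image_eqI[of _ _ "(a, b)"])
    qed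
  qed
  ultimately show ?thesis by simp
qed

end

section \<open>Uniform contraction\<close>

context lc_contraction_group
begin

lemma regular: "regular_space T"
  using locally_compact_Hausdorff_imp_regular_space locally_compact Hausdorff by blast

lemma aut_hom: "\<alpha> \<in> hom G G" and aut_bij: "bij_betw \<alpha> (carrier G) (carrier G)"
  using automorphism by (auto simp: iso_def)

lemma aut_closed [simp]: "x \<in> carrier G \<Longrightarrow> \<alpha> x \<in> carrier G"
  using aut_hom by (auto simp: hom_def)

lemma aut_mult: "x \<in> carrier G \<Longrightarrow> y \<in> carrier G \<Longrightarrow> \<alpha> (x \<otimes> y) = \<alpha> x \<otimes> \<alpha> y"
  using aut_hom by (auto simp: hom_def)

lemma aut_inv: "x \<in> carrier G \<Longrightarrow> \<alpha> (inv x) = inv (\<alpha> x)"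
  using group_hom.hom_inv[of G G \<alpha>] aut_hom is_group
  by (simp add: group_hom_def group_hom_axioms_def)

lemma aut_one: "\<alpha> \<one> = \<one>"
  using group_hom.hom_one[of G G \<alpha>] aut_hom is_group
  by (simp add: group_hom_def group_hom_axioms_def)

lemma aut_eqD: "\<alpha> x = \<alpha> y \<Longrightarrow> x \<in> carrier G \<Longrightarrow> y \<in> carrier G \<Longrightarrow> x = y"
  using aut_bij by (auto simp: bij_betw_def inj_on_def)

lemma aut_pow_closed [simp]: "x \<in> carrier G \<Longrightarrow> (\<alpha> ^^ n) x \<in> carrier G"
  by (induction n) auto

lemma aut_pow_mult:
  "x \<in> carrier G \<Longrightarrow> y \<in> carrier G \<Longrightarrow> (\<alpha> ^^ n) (x \<otimes> y) = (\<alpha> ^^ n) x \<otimes> (\<alpha> ^^ n) y"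
  by (induction n) (auto simp: aut_mult)

lemma aut_pow_one: "(\<alpha> ^^ n) \<one> = \<one>"
  by (induction n) (auto simp: aut_one)

lemma continuous_aut: "continuous_map T T \<alpha>"
  using bicontinuous homeomorphic_imp_continuous_map by blast

lemma continuous_aut_pow: "continuous_map T T (\<alpha> ^^ n)"
  by (induction n) (auto simp: id_def comp_def
      intro: continuous_map_compose[OF _ continuous_aut, unfolded comp_def])

lemma eventually_aut_pow_mem:
  assumes "x \<in> carrier G" "openin T U" "\<one> \<in> U"
  obtains n where "\<And>k. k \<ge> n \<Longrightarrow> (\<alpha> ^^ k) x \<in> U"
  using contractive[OF assms(1)] assms(2,3) unfolding limitin_sequentially by blast

lemma compact_neighbourhood:
  assumes "openin T W" "\<one> \<in> W"
  obtains U C where "openin T U" "compactin T C" "closedin T C" "\<one> \<in> U" "U \<subseteq> C" "C \<subseteq> W"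
proof -
  have "neighbourhood_base_of (\<lambda>C. compactin T C \<and> closedin T C) T"
    using locally_compact_space_neighbourhood_base_closedin Hausdorff locally_compact by blast
  then show thesis
    using assms that unfolding neighbourhood_base_of by metis
qed

text \<open>Baire category: for a closed neighbourhood \<open>C\<close> of the identity, one of the closed sets
  \<open>{x. \<forall>k\<ge>n. \<alpha>\<^sup>k x \<in> C}\<close> has an interior point, whose translate back to the identity gives
  the desired neighbourhood.\<close>

lemma equicontractive:
  assumes W: "openin T W" "\<one> \<in> W"
  obtains V where "openin T V" "\<one> \<in> V" "\<And>k x. x \<in> V \<Longrightarrow> (\<alpha> ^^ k) x \<in> W"
proof -
  obtain V where V: "openin T V" "\<one> \<in> V" "\<And>a b. a \<in> V \<Longrightarrow> b \<in> V \<Longrightarrow> inv a \<otimes> b \<in> W"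
    using neighbourhood_inv_mult[OF W] by metis
  obtain U C where C: "openin T U" "closedin T C" "\<one> \<in> U" "U \<subseteq> C" "C \<subseteq> V"
    using compact_neighbourhood[OF V(1,2)] by metis
  define B where "B n = {x \<in> carrier G. \<forall>k\<ge>n. (\<alpha> ^^ k) x \<in> C}" for n
  have closed_B: "closedin T (B n)" for n
  proof -
    have "B n = (\<Inter>k\<in>{n..}. {x \<in> topspace T. (\<alpha> ^^ k) x \<in> C})"
      by (auto simp: B_def topspace_eq)
    moreover have "closedin T {x \<in> topspace T. (\<alpha> ^^ k) x \<in> C}" for k
      using closedin_continuous_map_preimage[OF continuous_aut_pow C(2)] .
    ultimately show ?thesis by (auto intro!: closedin_Inter)
  qed
  have "\<exists>n. T interior_of (B n) \<noteq> {}"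
  proof (rule ccontr)
    assume "\<not> ?thesis"
    then have "T interior_of \<Union>(range B) = {}"
      using Baire_category_alt[of T "range B"] locally_compact regular closed_B by auto
    moreover have "\<Union>(range B) = topspace T"
    proof
      show "topspace T \<subseteq> \<Union>(range B)"
      proof
        fix x assume "x \<in> topspace T"
        then have x: "x \<in> carrier G" by (simp add: topspace_eq)
        then obtain n where "\<And>k. k \<ge> n \<Longrightarrow> (\<alpha> ^^ k) x \<in> U"
          using eventually_aut_pow_mem[OF _ C(1,3)] by metis
        then show "x \<in> \<Union>(range B)" using x C by (auto simp: B_def)
      qed
    qed (auto simp: B_def topspace_eq)
    ultimately show False
      using one_closed topspace_eq by (metis empty_iff interior_of_topspace)
  qed
  then obtain n x where x: "x \<in> T interior_of (B n)" by blast
  have xB: "x \<in> B n" using x interior_of_subset by fast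
  have xG: "x \<in> carrier G" using xB by (simp add: B_def)
  define O1 where "O1 = {y \<in> carrier G. x \<otimes> y \<in> T interior_of (B n)}"
  have O1: "openin T O1" "\<one> \<in> O1"
    using openin_left_translate[OF openin_interior_of xG] x xG by (auto simp: O1_def)
  \<comment> \<open>Moves the interior point x to the identity: x and xy both lie in
    \<open>B n\<close>, so for k >= n the quotient of their images lies in V^-1 V, hence in
    W.\<close>
  have late: "(\<alpha> ^^ k) y \<in> W" if "y \<in> O1" "k \<ge> n" for k y
  proof -
    have y: "y \<in> carrier G" "x \<otimes> y \<in> B n"
      using that interior_of_subset by (fastforce simp: O1_def)+
    have "(\<alpha> ^^ k) y = inv ((\<alpha> ^^ k) x) \<otimes> (\<alpha> ^^ k) (x \<otimes> y)"
      using xG y by (simp add: aut_pow_mult m_assoc[symmetric])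
    moreover have "(\<alpha> ^^ k) x \<in> V" "(\<alpha> ^^ k) (x \<otimes> y) \<in> V"
      using xB y C that by (auto simp: B_def)
    ultimately show ?thesis using V(3) by simp
  qed
  \<comment> \<open>The Baire argument controls only the exponents k >= n; the finitely many smaller
    ones are handled by continuity of each power at the identity.\<close>
  define O2 where "O2 = O1 \<inter> \<Inter>((\<lambda>k. {x \<in> topspace T. (\<alpha> ^^ k) x \<in> W}) ` {..n})"
  show thesis
  proof (rule that[of O2])
    show "openin T O2" unfolding O2_def
      using O1 openin_continuous_map_preimage[OF continuous_aut_pow W(1)]
      by (intro openin_Int openin_Inter) auto
    show "\<one> \<in> O2" using O1 W by (auto simp: O2_def topspace_eq aut_pow_one)
    fix k x assume "x \<in> O2"
    then show "(\<alpha> ^^ k) x \<in> W"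
      using late[of x k] by (cases "k \<le> n") (auto simp: O2_def)
  qed
qed

text \<open>Finitely many translates xU cover K. At the centres x pointwise contraction suffices, on
  U all powers are controlled at once by \<open>equicontractive\<close>, and the two estimates
  multiply.\<close>

lemma uniformly_contractive:
  assumes K: "compactin T K" and W: "openin T W" "\<one> \<in> W"
  obtains n where "\<And>k x. k \<ge> n \<Longrightarrow> x \<in> K \<Longrightarrow> (\<alpha> ^^ k) x \<in> W"
proof -
  have KG: "K \<subseteq> carrier G" using compactin_subset_topspace[OF K] topspace_eq by simp
  obtain V where V: "openin T V" "\<one> \<in> V" "\<And>a b. a \<in> V \<Longrightarrow> b \<in> V \<Longrightarrow> a \<otimes> b \<in> W"
    using neighbourhood_mult[OF W] by metis
  obtain U where U: "openin T U" "\<one> \<in> U" "\<And>k x. x \<in> U \<Longrightarrow> (\<alpha> ^^ k) x \<in> V"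
    using equicontractive[OF V(1,2)] by metis
  obtain F where F: "finite F" "F \<subseteq> K" "K \<subseteq> (\<Union>x\<in>F. {y \<in> carrier G. inv x \<otimes> y \<in> U})"
    by (rule compact_cover_translates[OF K U(1,2)])
  have "\<exists>n. \<forall>k\<ge>n. (\<alpha> ^^ k) x \<in> V" if "x \<in> F" for x
  proof -
    have "x \<in> carrier G" using that F(2) KG by auto
    then show ?thesis by (rule eventually_aut_pow_mem[OF _ V(1,2)]) auto
  qed
  then obtain n where n: "\<And>x k. x \<in> F \<Longrightarrow> k \<ge> n x \<Longrightarrow> (\<alpha> ^^ k) x \<in> V" by metis
  show thesis
  \<comment> \<open>If F is empty then so is K, and the value of \<open>Max\<close> is
    immaterial.\<close>
  proof (rule that[of "Max (n ` F)"])
    fix k y assume k: "k \<ge> Max (n ` F)" and y: "y \<in> K"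
    obtain x where x: "x \<in> F" "y \<in> carrier G" "inv x \<otimes> y \<in> U" using F y by blast
    have xG: "x \<in> carrier G" using x F KG by blast
    have "n x \<le> k" using k x(1) F(1) by (meson Max_ge finite_imageI imageI order_trans)
    then have "(\<alpha> ^^ k) x \<otimes> (\<alpha> ^^ k) (inv x \<otimes> y) \<in> W" using V(3) n x U(3) by blast
    moreover have "x \<otimes> (inv x \<otimes> y) = y" using xG x by (simp add: m_assoc[symmetric])
    ultimately show "(\<alpha> ^^ k) y \<in> W" using xG x(2) by (metis aut_pow_mult inv_closed m_closed)
  qed
qed

subsection \<open>Chains of stable subgroups\<close>

definition stable_subgroup :: "'a set \<Rightarrow> bool"
  where "stable_subgroup H \<longleftrightarrow> subgroup H G \<and> closedin T H \<and> \<alpha> ` H = H"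

lemma stable_subgroupD:
  assumes "stable_subgroup H"
  shows "subgroup H G" "closedin T H" "\<alpha> ` H = H" "H \<subseteq> carrier G" "\<one> \<in> H"
  using assms subgroup.subset subgroup.one_closed unfolding stable_subgroup_def by auto

lemma stable_subgroup_Int:
  assumes "stable_subgroup H" "stable_subgroup K"
  shows "stable_subgroup (H \<inter> K)"
proof -
  have "\<alpha> ` (H \<inter> K) = \<alpha> ` H \<inter> \<alpha> ` K"
    using aut_bij stable_subgroupD(4)[OF assms(1)] stable_subgroupD(4)[OF assms(2)]
    by (intro inj_on_image_Int[of _ "carrier G"]) (auto simp: bij_betw_def)
  then show ?thesis
    using assms subgroups_Inter_pair unfolding stable_subgroup_def by auto
qed

text \<open>Because membership in a stable set can be tested after applying powers of \<alpha>, the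
  rescaling arguments below get by with nonnegative powers and never name the inverse of
  \<alpha>.\<close>

lemma aut_pow_mem_iff:
  assumes "A \<subseteq> carrier G" "\<alpha> ` A = A" "x \<in> carrier G"
  shows "(\<alpha> ^^ n) x \<in> A \<longleftrightarrow> x \<in> A"
proof (induction n)
  case (Suc n)
  have "\<alpha> ((\<alpha> ^^ n) x) \<in> \<alpha> ` A \<longleftrightarrow> (\<alpha> ^^ n) x \<in> A"
    using aut_bij assms by (intro inj_on_image_mem_iff[of _ "carrier G"]) (auto simp: bij_betw_def)
  then show ?case using Suc assms(2) by simp
qed simp

lemma stable_subgroup_pow_iff:
  "stable_subgroup H \<Longrightarrow> x \<in> carrier G \<Longrightarrow> (\<alpha> ^^ n) x \<in> H \<longleftrightarrow> x \<in> H"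
  by (rule aut_pow_mem_iff) (auto dest: stable_subgroupD)

lemma stable_subgroup_aut_iff:
  assumes "stable_subgroup H" "x \<in> carrier G"
  shows "\<alpha> x \<in> H \<longleftrightarrow> x \<in> H"
  using stable_subgroup_pow_iff[OF assms, of 1] by simp

lemma openin_aut_image: "openin T U \<Longrightarrow> openin T (\<alpha> ` U)"
  using bicontinuous by (meson homeomorphic_imp_open_map open_map_def)

text \<open>V and U are fixed before H and L; this uniformity is what a bound on chain lengths
  needs. Take x in L - H, contracted into V. Since H is closed and high powers of \<alpha> push V
  close to the identity, x lies in H \<alpha>^k(V) for only finitely many k. For the greatest such k
  write x = h \<alpha>^k(v): then v belongs to L, and maximality keeps v out of H
  \<alpha>(\<open>U0\<close>).\<close>

lemma stable_subgroup_separation: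
  obtains V U where "compactin T V" "openin T U" "\<one> \<in> U"
    "\<forall>H L. stable_subgroup H \<and> stable_subgroup L \<and> H \<subset> L \<longrightarrow>
       (\<exists>v \<in> L \<inter> V. \<forall>h\<in>H. \<forall>u\<in>U. v \<noteq> h \<otimes> u)"
proof -
  have "openin T (carrier G)" using topspace_eq by (metis openin_topspace)
  then obtain U0 V where V: "openin T U0" "compactin T V" "\<one> \<in> U0" "U0 \<subseteq> V"
    using compact_neighbourhood[of "carrier G"] one_closed by metis
  have VG: "V \<subseteq> carrier G" using compactin_subset_topspace[OF V(2)] topspace_eq by simp
  show thesis
  proof (rule that[of V "\<alpha> ` U0"])
    show "compactin T V" "openin T (\<alpha> ` U0)" "\<one> \<in> \<alpha> ` U0"
      using V openin_aut_image aut_one by (auto intro!: image_eqI[of _ _ \<one>])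
  next
    show "\<forall>H L. stable_subgroup H \<and> stable_subgroup L \<and> H \<subset> L \<longrightarrow>
       (\<exists>v \<in> L \<inter> V. \<forall>h\<in>H. \<forall>u\<in>\<alpha> ` U0. v \<noteq> h \<otimes> u)"
    proof (intro allI impI, elim conjE)
      fix H L assume H: "stable_subgroup H" and L: "stable_subgroup L" and HL: "H \<subset> L"
      note HD = stable_subgroupD[OF H] and LD = stable_subgroupD[OF L]
      obtain x0 where x0: "x0 \<in> L" "x0 \<notin> H" using HL by blast
      then have x0G: "x0 \<in> carrier G" using LD(4) by blast
      obtain m where "(\<alpha> ^^ m) x0 \<in> U0" using eventually_aut_pow_mem[OF x0G V(1,3)] by blast
      define x where "x = (\<alpha> ^^ m) x0"
      have x: "x \<in> V" "x \<in> L" "x \<notin> H" "x \<in> carrier G"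
        using \<open>(\<alpha> ^^ m) x0 \<in> U0\<close> V x0 x0G stable_subgroup_pow_iff[OF H x0G] stable_subgroup_pow_iff[OF L x0G]
        by (auto simp: x_def)
      define P where "P k \<longleftrightarrow> (\<exists>h\<in>H. \<exists>v\<in>V. x = h \<otimes> (\<alpha> ^^ k) v)" for k
      have P0: "P 0" unfolding P_def
        using x HD(5) by (intro bexI[of _ \<one>] bexI[of _ x]) auto
      \<comment> \<open>W consists of the w with x not in Hw. It contains the identity and is open
        because H is closed, so \<open>P k\<close> fails as soon as \<alpha>^k(V) lies in W.\<close>
      define W where "W = {w \<in> carrier G. x \<otimes> inv w \<in> carrier G - H}"
      have W: "openin T W"
        using openin_continuous_map_preimage[OF continuous_map_mult[OF _ continuous_inv], of "\<lambda>_. x" "carrier G - H"]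
          x(4) HD(2) unfolding W_def closedin_def by (simp add: topspace_eq)
      have W1: "\<one> \<in> W" using x by (simp add: W_def)
      obtain n where n: "\<And>k v. k \<ge> n \<Longrightarrow> v \<in> V \<Longrightarrow> (\<alpha> ^^ k) v \<in> W"
        using uniformly_contractive[OF V(2) W W1] by metis
      have bound: "k \<le> n" if Pk: "P k" for k
      proof (rule ccontr)
        assume "\<not> k \<le> n"
        obtain h v where hv: "h \<in> H" "v \<in> V" "x = h \<otimes> (\<alpha> ^^ k) v" using Pk P_def by blast
        have "x \<otimes> inv ((\<alpha> ^^ k) v) = h"
          using hv HD(4) VG by (simp add: m_assoc subset_iff)
        then show False using n[of k v] hv \<open>\<not> k \<le> n\<close> by (simp add: W_def)
      qed
      define k where "k = Greatest P"
      have Pk: "P k" unfolding k_def by (rule GreatestI_nat[of P, OF P0]) (use bound in blast)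
      have nPk: "\<not> P (Suc k)"
        using Greatest_le_nat[of P "Suc k" n] bound unfolding k_def by force
      obtain h v where hv: "h \<in> H" "v \<in> V" "x = h \<otimes> (\<alpha> ^^ k) v" using Pk P_def by blast
      have vG: "v \<in> carrier G" and hG: "h \<in> carrier G" using hv VG HD(4) by auto
      have "(\<alpha> ^^ k) v = inv h \<otimes> x" using hv vG hG by (simp add: m_assoc[symmetric])
      then have "(\<alpha> ^^ k) v \<in> L"
        using hv(1) HL x(2) LD(1) by (metis psubsetD subgroup.m_closed subgroup.m_inv_closed)
      then have "v \<in> L" using stable_subgroup_pow_iff[OF L vG] by simp
      \<comment> \<open>If v = h' \<alpha>(w) with w in \<open>U0\<close>, then x = h \<alpha>^k(h')
        \<alpha>^(k+1)(w), contradicting the choice of k.\<close>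
      moreover have "v \<noteq> h' \<otimes> u" if h': "h' \<in> H" "u \<in> \<alpha> ` U0" for h' u
      proof
        assume v: "v = h' \<otimes> u"
        obtain w where w: "w \<in> U0" "u = \<alpha> w" using h' by blast
        have h'G: "h' \<in> carrier G" and wG: "w \<in> carrier G" using h' HD(4) w V VG by auto
        have "x = (h \<otimes> (\<alpha> ^^ k) h') \<otimes> (\<alpha> ^^ Suc k) w"
          using hv(3) v w h'G wG hG by (simp add: aut_pow_mult m_assoc funpow_swap1)
        moreover have "h \<otimes> (\<alpha> ^^ k) h' \<in> H"
          using hv(1) h'(1) h'G stable_subgroup_pow_iff[OF H h'G] HD(1) by (simp add: subgroup.m_closed)
        ultimately have "P (Suc k)" unfolding P_def using w V by blast
        then show False using nPk by simp
      qed
      ultimately show "\<exists>v \<in> L \<inter> V. \<forall>h\<in>H. \<forall>u\<in>\<alpha> ` U0. v \<noteq> h \<otimes> u" using hv(2) by blast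
    qed
  qed
qed

text \<open>Pigeonhole. The bound is the number of translates of W that cover V, where W^-1 W lies
  in U. Each step of the chain yields a point \<open>v j\<close> of V; for i < j, two such points in
  one translate would give (v i)^-1 (v j) in U with \<open>v i\<close> in \<open>S (Suc i)\<close>,
  hence in \<open>S j\<close>, which the separation forbids. So the steps inject into the set of
  centres.\<close>

lemma stable_chain_bound:
  obtains N where "\<And>n S. (\<And>j. j \<le> n \<Longrightarrow> stable_subgroup (S j)) \<Longrightarrow>
    (\<And>j. j < n \<Longrightarrow> S j \<subset> S (Suc j)) \<Longrightarrow> n \<le> N"
proof -
  obtain V U where V: "compactin T V" and U: "openin T U" "\<one> \<in> U"
    and sep: "\<forall>H L. stable_subgroup H \<and> stable_subgroup L \<and> H \<subset> L \<longrightarrow>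
       (\<exists>v \<in> L \<inter> V. \<forall>h\<in>H. \<forall>u\<in>U. v \<noteq> h \<otimes> u)"
    by (rule stable_subgroup_separation)
  obtain W where W: "openin T W" "\<one> \<in> W" "\<And>a b. a \<in> W \<Longrightarrow> b \<in> W \<Longrightarrow> inv a \<otimes> b \<in> U"
    using neighbourhood_inv_mult[OF U] by metis
  obtain F where F: "finite F" "F \<subseteq> V" "V \<subseteq> (\<Union>x\<in>F. {y \<in> carrier G. inv x \<otimes> y \<in> W})"
    by (rule compact_cover_translates[OF V W(1,2)])
  have FG: "F \<subseteq> carrier G" using F(2) compactin_subset_topspace[OF V] topspace_eq by simp
  show thesis
  proof (rule that[of "card F"])
    fix n S assume S: "\<And>j. j \<le> n \<Longrightarrow> stable_subgroup (S j)"
      and inc: "\<And>j. j < n \<Longrightarrow> S j \<subset> S (Suc j)"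
    have "\<exists>v. v \<in> S (Suc j) \<inter> V \<and> (\<forall>h\<in>S j. \<forall>u\<in>U. v \<noteq> h \<otimes> u)" if "j < n" for j
      using sep[rule_format, of "S j" "S (Suc j)"] S inc that by auto
    then obtain v where v: "\<And>j. j < n \<Longrightarrow> v j \<in> S (Suc j) \<inter> V"
      and vU: "\<And>j h u. j < n \<Longrightarrow> h \<in> S j \<Longrightarrow> u \<in> U \<Longrightarrow> v j \<noteq> h \<otimes> u"
      by metis
    have "\<exists>y. y \<in> F \<and> v j \<in> carrier G \<and> inv y \<otimes> v j \<in> W" if "j < n" for j
      using v[OF that] F(3) by blast
    then obtain f where f: "\<And>j. j < n \<Longrightarrow> f j \<in> F" "\<And>j. j < n \<Longrightarrow> v j \<in> carrier G"
      "\<And>j. j < n \<Longrightarrow> inv (f j) \<otimes> v j \<in> W"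
      by metis
    have mono: "S i \<subseteq> S j" if "i \<le> j" "j \<le> n" for i j
      using that
    proof (induction j rule: dec_induct)
      case (step k)
      then show ?case using inc[of k] by auto
    qed simp
    have ne: "f i \<noteq> f j" if ij: "i < j" "j < n" for i j
    proof
      assume eq: "f i = f j"
      have G: "f j \<in> carrier G" "v i \<in> carrier G" "v j \<in> carrier G" using f ij FG by auto
      have "inv (inv (f j) \<otimes> v i) \<otimes> (inv (f j) \<otimes> v j) \<in> U"
        using W(3) f(3)[of i] f(3)[of j] ij eq by simp
      moreover have "inv (inv (f j) \<otimes> v i) \<otimes> (inv (f j) \<otimes> v j) = inv (v i) \<otimes> v j"
        using G by (simp add: inv_mult_group m_assoc inv_cancel_left)
      ultimately have "inv (v i) \<otimes> v j \<in> U" by simp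
      moreover have "v j = v i \<otimes> (inv (v i) \<otimes> v j)" using G by (simp add: m_assoc[symmetric])
      moreover have "v i \<in> S j" using v[of i] mono[of "Suc i" j] ij by auto
      ultimately show False using vU[of j] ij by blast
    qed
    have "inj_on f {..<n}"
      by (rule inj_onI) (metis ne lessThan_iff linorder_neqE_nat)
    then have "card {..<n} \<le> card F"
      by (rule card_inj_on_le) (use f F in auto)
    then show "n \<le> card F" by simp
  qed
qed

subsection \<open>Products of stable subgroups\<close>

text \<open>The factor h of hn is determined up to D = H \<inter> N. A consists of the points of C
  that no element of D moves into \<alpha>(U). It is compact, and AN is closed and misses the
  identity, so the whole forward orbit of a small W avoids AN. If h were outside CD, let
  \<alpha>^(k+1)(h) = cd be the first orbit point in CD. Were c outside A, this equation could be
  pulled back along \<alpha> and would put \<alpha>^k(h) in CD. So c is in A and \<alpha>^(k+1)(hn)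
  is in AN, a contradiction. Hence h = cd, and hn = c(dn) lies in CN.\<close>

lemma stable_subgroup_product_neighbourhood:
  assumes H: "stable_subgroup H" and N: "stable_subgroup N" and O1: "openin T O1" "\<one> \<in> O1"
  obtains C W where "compactin T C" "C \<subseteq> O1 \<inter> H" "openin T W" "\<one> \<in> W" "(H <#> N) \<inter> W \<subseteq> C <#> N"
proof -
  note HD = stable_subgroupD[OF H] and ND = stable_subgroupD[OF N]
  define D where "D = H \<inter> N"
  have D: "stable_subgroup D" unfolding D_def by (rule stable_subgroup_Int[OF H N])
  note DD = stable_subgroupD[OF D]
  obtain U C0 where U: "openin T U" "compactin T C0" "\<one> \<in> U" "U \<subseteq> C0" "C0 \<subseteq> O1"
    using compact_neighbourhood[OF O1] by metis
  define C where "C = C0 \<inter> H"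
  have C: "compactin T C" unfolding C_def using U HD(2) by (simp add: compact_Int_closedin)
  have CG: "C \<subseteq> carrier G" and CH: "C \<subseteq> H" using HD(4) by (auto simp: C_def)
  define B where "B = (\<Union>d\<in>D. {c \<in> carrier G. c \<otimes> d \<in> \<alpha> ` U})"
  have B: "openin T B" unfolding B_def
    using DD(4) openin_right_translate[OF openin_aut_image[OF U(1)]] by auto
  define A where "A = C - B"
  have "A = C \<inter> (topspace T - B)" using CG by (auto simp: A_def topspace_eq)
  then have A: "compactin T A"
    using compact_Int_closedin[OF C closedin_diff[OF closedin_topspace B]] by simp
  have AG: "A \<subseteq> carrier G" using CG by (auto simp: A_def)
  define W0 where "W0 = carrier G - (A <#> N)"
  have W0: "openin T W0"
    using closedin_compact_mult_closed[OF A ND(2)] unfolding W0_def closedin_def topspace_eq by blast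
  \<comment> \<open>The equation 1 = an forces n = a^-1 into D. Then n moves a to 1, which lies in
    \<alpha>(U), so a belongs to B.\<close>
  have "\<one> \<notin> A <#> N"
  proof
    assume "\<one> \<in> A <#> N"
    then obtain a n where an: "a \<in> A" "n \<in> N" "\<one> = a \<otimes> n" unfolding set_mult_def by blast
    have G: "a \<in> carrier G" "n \<in> carrier G" using an AG ND(4) by auto
    then have "n = inv a" using an(3) by (metis inv_equality inv_inv)
    then have "n \<in> D"
      using an CH HD(1) by (auto simp: D_def A_def subgroup.m_inv_closed)
    moreover have "a \<otimes> n \<in> \<alpha> ` U" using U(3) an(3) aut_one by (metis imageI)
    ultimately have "a \<in> B" using G by (auto simp: B_def)
    then show False using an by (simp add: A_def)
  qed
  then have "\<one> \<in> W0" by (simp add: W0_def)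
  then obtain W where W: "openin T W" "\<one> \<in> W" "\<And>k x. x \<in> W \<Longrightarrow> (\<alpha> ^^ k) x \<in> W0"
    using equicontractive[OF W0] by metis
  have "h \<in> C <#> D" if h: "h \<in> H" "n \<in> N" "h \<otimes> n \<in> W" for h n
  proof (rule ccontr)
    assume nh: "h \<notin> C <#> D"
    have hG: "h \<in> carrier G" and nG: "n \<in> carrier G" using h HD(4) ND(4) by auto
    obtain m where m: "(\<alpha> ^^ m) h \<in> U" using eventually_aut_pow_mem[OF hG U(1,3)] by blast
    have "(\<alpha> ^^ m) h \<in> C" using m U h(1) stable_subgroup_pow_iff[OF H hG] by (auto simp: C_def)
    moreover have "(\<alpha> ^^ m) h \<otimes> \<one> = (\<alpha> ^^ m) h" using hG by simp
    ultimately have "(\<alpha> ^^ m) h \<in> C <#> D" using DD(5) unfolding set_mult_def by blast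
    then obtain k where k: "(\<alpha> ^^ k) h \<notin> C <#> D" "(\<alpha> ^^ Suc k) h \<in> C <#> D"
      using nh ex_least_nat_less[of "\<lambda>k. (\<alpha> ^^ k) h \<in> C <#> D" m] by auto
    obtain c d where cd: "c \<in> C" "d \<in> D" "(\<alpha> ^^ Suc k) h = c \<otimes> d"
      using k(2) unfolding set_mult_def by blast
    have G: "c \<in> carrier G" "d \<in> carrier G" using cd CG DD(4) by auto
    \<comment> \<open>If cd' = \<alpha>(u) with u in U, then u lies in C, and d'^-1 d = \<alpha>(e)
      with e in D. So \<alpha>(ue) = cd = \<alpha>^(k+1)(h), and injectivity gives \<alpha>^k(h) =
      ue in CD.\<close>
    have "c \<notin> B"
    proof
      assume "c \<in> B"
      then obtain d' u where d': "d' \<in> D" "u \<in> U" "c \<otimes> d' = \<alpha> u" by (auto simp: B_def)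
      have G': "d' \<in> carrier G" "u \<in> carrier G" using d' DD(4) openin_carrier[OF U(1)] by auto
      have "\<alpha> u \<in> H" using d' cd CH HD(1) by (metis D_def IntD1 subgroup.m_closed subsetD)
      then have uC: "u \<in> C" using d' U stable_subgroup_aut_iff[OF H G'(2)] by (auto simp: C_def)
      have "inv d' \<otimes> d \<in> D" using d' cd DD(1) by (simp add: subgroup.m_closed subgroup.m_inv_closed)
      then obtain e where e: "e \<in> D" "\<alpha> e = inv d' \<otimes> d" using DD(3) by (metis imageE)
      have eG: "e \<in> carrier G" using e DD(4) by auto
      have "\<alpha> (u \<otimes> e) = (c \<otimes> d') \<otimes> (inv d' \<otimes> d)" using G' eG e d' by (simp add: aut_mult)
      also have "\<dots> = \<alpha> ((\<alpha> ^^ k) h)" using G G' cd(3) by (simp add: m_assoc inv_cancel_left)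
      finally have "u \<otimes> e = (\<alpha> ^^ k) h" using aut_eqD G' eG hG by (metis m_closed aut_pow_closed)
      then show False using k(1) uC e(1) unfolding set_mult_def by blast
    qed
    then have "c \<in> A" using cd by (simp add: A_def)
    have "(\<alpha> ^^ Suc k) (h \<otimes> n) = c \<otimes> (d \<otimes> (\<alpha> ^^ Suc k) n)"
      using cd(3) G hG nG aut_pow_mult[OF hG nG, of "Suc k"] aut_pow_closed[OF nG, of "Suc k"]
      by (simp add: m_assoc)
    moreover have "d \<otimes> (\<alpha> ^^ Suc k) n \<in> N"
      using cd(2) stable_subgroup_pow_iff[OF N nG] h(2) ND(1) by (metis D_def IntD2 subgroup.m_closed)
    ultimately have "(\<alpha> ^^ Suc k) (h \<otimes> n) \<in> A <#> N"
      using \<open>c \<in> A\<close> unfolding set_mult_def by blast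
    then show False using W(3)[OF h(3), of "Suc k"] by (simp add: W0_def)
  qed
  note * = this
  have "(H <#> N) \<inter> W \<subseteq> C <#> N"
  proof
    fix x assume "x \<in> (H <#> N) \<inter> W"
    then obtain h n where x: "x = h \<otimes> n" "h \<in> H" "n \<in> N" "h \<otimes> n \<in> W"
      unfolding set_mult_def by blast
    obtain c d where cd: "c \<in> C" "d \<in> D" "h = c \<otimes> d"
      using *[OF x(2-4)] unfolding set_mult_def by blast
    have "d \<otimes> n \<in> N" using cd x ND(1) by (simp add: D_def subgroup.m_closed)
    moreover have "x = c \<otimes> (d \<otimes> n)" using x cd CG DD(4) ND(4) by (simp add: m_assoc subset_iff)
    ultimately show "x \<in> C <#> N" using cd unfolding set_mult_def by blast
  qed
  then show thesis using that[of C W] C U(5) W by (auto simp: C_def)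
qed

lemma closedin_stable_product:
  assumes H: "stable_subgroup H" and N: "stable_subgroup N"
  shows "closedin T (H <#> N)"
proof -
  note HD = stable_subgroupD[OF H] and ND = stable_subgroupD[OF N]
  have "openin T (carrier G)" using topspace_eq by (metis openin_topspace)
  then obtain C W where CW: "compactin T C" "C \<subseteq> carrier G \<inter> H" "openin T W" "\<one> \<in> W"
      "(H <#> N) \<inter> W \<subseteq> C <#> N"
    by (rule stable_subgroup_product_neighbourhood[OF H N _ one_closed])
  have sub: "H <#> N \<subseteq> carrier G" using HD(4) ND(4) by (simp add: set_mult_closed)
  have CN: "closedin T (C <#> N)" by (rule closedin_compact_mult_closed[OF CW(1) ND(2)])
  have CNs: "C <#> N \<subseteq> H <#> N" using CW(2) by (simp add: mono_set_mult)
  have img: "\<alpha> ` (H <#> N) = H <#> N"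
    using set_mult_hom[OF aut_hom HD(4) ND(4)] HD(3) ND(3) by simp
  note stable = aut_pow_mem_iff[OF sub img]
  have "T closure_of (H <#> N) \<subseteq> H <#> N"
  proof
    fix y assume y: "y \<in> T closure_of (H <#> N)"
    then have yG: "y \<in> carrier G" by (simp add: in_closure_of topspace_eq)
    obtain k where k: "(\<alpha> ^^ k) y \<in> W" using eventually_aut_pow_mem[OF yG CW(3,4)] by blast
    have "(\<alpha> ^^ k) y \<in> C <#> N"
    proof (rule ccontr)
      assume ny: "(\<alpha> ^^ k) y \<notin> C <#> N"
      \<comment> \<open>Q is an open neighbourhood of the limit point y. A point z of HN in Q would
        have \<alpha>^k(z) in HN \<inter> W but outside CN.\<close>
      define Q where "Q = {z \<in> topspace T. (\<alpha> ^^ k) z \<in> W \<inter> (topspace T - (C <#> N))}"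
      have "openin T Q" unfolding Q_def
        using CW(3) CN by (intro openin_continuous_map_preimage[OF continuous_aut_pow]) auto
      moreover have "y \<in> Q" using k ny yG by (simp add: Q_def topspace_eq)
      ultimately obtain z where z: "z \<in> H <#> N" "z \<in> Q" using y unfolding in_closure_of by blast
      then have "(\<alpha> ^^ k) z \<in> (H <#> N) \<inter> W" using stable[of z k] sub by (auto simp: Q_def topspace_eq)
      then show False using CW(5) z by (auto simp: Q_def)
    qed
    then show "y \<in> H <#> N" using stable[OF yG] CNs by blast
  qed
  then show ?thesis using sub topspace_eq by (metis closure_of_subset closure_of_eq subset_antisym)
qed

end

section \<open>Subgroups and quotients\<close>

lemma (in group) rcos_eq_iff:
  assumes "subgroup N G" "x \<in> carrier G" "y \<in> carrier G"
  shows "N #> x = N #> y \<longleftrightarrow> x \<otimes> inv y \<in> N"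
proof
  assume "N #> x = N #> y"
  then have "x \<in> N #> y" using rcos_self assms by blast
  then show "x \<otimes> inv y \<in> N" using subgroup.rcos_module_imp[OF assms(1) is_group assms(3)] by blast
next
  assume "x \<otimes> inv y \<in> N"
  then have "x \<in> N #> y" using subgroup.rcos_module_rev[OF assms(1) is_group assms(3,2)] by blast
  then show "N #> x = N #> y" using repr_independence assms by metis
qed

text \<open>\<open>contraction_group_isomorphic\<close> assumes nothing about its arguments. The
  inverse map therefore needs both topspaces to be the carriers, and its equivariance needs \<alpha>
  to preserve the carrier.\<close>

lemma contraction_group_isomorphic_sym:
  assumes iso: "contraction_group_isomorphic G T \<alpha> H U \<beta>"
    and T: "topspace T = carrier G" and U: "topspace U = carrier H"
    and closed: "\<alpha> ` carrier G \<subseteq> carrier G" "group G"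
  shows "contraction_group_isomorphic H U \<beta> G T \<alpha>"
proof -
  interpret group G by fact
  obtain f where f: "f \<in> iso G H" "homeomorphic_map T U f" "\<And>x. x \<in> carrier G \<Longrightarrow> \<beta> (f x) = f (\<alpha> x)"
    using iso unfolding contraction_group_isomorphic_def by blast
  then obtain g where "homeomorphic_maps T U f g" using homeomorphic_map_maps by blast
  then have g: "homeomorphic_map U T g" "\<And>x. x \<in> carrier G \<Longrightarrow> g (f x) = x"
      "\<And>y. y \<in> carrier H \<Longrightarrow> f (g y) = y"
    using T U by (auto simp: homeomorphic_maps_map)
  have bij: "g ` carrier H = carrier G"
    using homeomorphic_imp_surjective_map[OF g(1)] T U by simp
  have "inj_on g (carrier H)" using g(3) by (metis inj_onI)
  moreover have "g (x \<otimes>\<^bsub>H\<^esub> y) = g x \<otimes>\<^bsub>G\<^esub> g y" if "x \<in> carrier H" "y \<in> carrier H" for x y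
  proof -
    have gx: "g x \<in> carrier G" "g y \<in> carrier G" using that bij by auto
    then have "f (g x \<otimes>\<^bsub>G\<^esub> g y) = x \<otimes>\<^bsub>H\<^esub> y"
      using f(1) g(3) that by (simp add: iso_def hom_def)
    then show ?thesis using g(2) gx m_closed by metis
  qed
  ultimately have "g \<in> iso H G"
    using bij by (auto simp: iso_def hom_def bij_betw_def)
  moreover have "\<alpha> (g y) = g (\<beta> y)" if "y \<in> carrier H" for y
  proof -
    have gy: "g y \<in> carrier G" using that bij by auto
    then have "\<alpha> (g y) \<in> carrier G" using closed by auto
    then show ?thesis using f(3)[OF gy] g that by metis
  qed
  ultimately show ?thesis using g(1) unfolding contraction_group_isomorphic_def by blast
qed

lemma contraction_group_isomorphic_trans:
  assumes "contraction_group_isomorphic G T \<alpha> H U \<beta>" "contraction_group_isomorphic H U \<beta> K V \<gamma>"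
  shows "contraction_group_isomorphic G T \<alpha> K V \<gamma>"
proof -
  obtain f where f: "f \<in> iso G H" "homeomorphic_map T U f" "\<And>x. x \<in> carrier G \<Longrightarrow> \<beta> (f x) = f (\<alpha> x)"
    using assms(1) unfolding contraction_group_isomorphic_def by blast
  obtain g where g: "g \<in> iso H K" "homeomorphic_map U V g" "\<And>x. x \<in> carrier H \<Longrightarrow> \<gamma> (g x) = g (\<beta> x)"
    using assms(2) unfolding contraction_group_isomorphic_def by blast
  have "g \<circ> f \<in> iso G K" using f g iso_set_trans by blast
  moreover have "homeomorphic_map T V (g \<circ> f)" using f g homeomorphic_map_compose by blast
  moreover have "f x \<in> carrier H" if "x \<in> carrier G" for x
    using f(1) that by (auto simp: iso_def hom_def)
  ultimately show ?thesis
    unfolding contraction_group_isomorphic_def using f(3) g(3) by (intro exI[of _ "g \<circ> f"]) auto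
qed

context lc_contraction_group
begin

lemma stable_subgroup_contraction_group:
  assumes H: "stable_subgroup H"
  shows "lc_contraction_group (G\<lparr>carrier := H\<rparr>) (subtopology T H) \<alpha>"
proof -
  note HD = stable_subgroupD[OF H]
  interpret S: group "G\<lparr>carrier := H\<rparr>" using subgroup_imp_group[OF HD(1)] .
  have ts: "topspace (subtopology T H) = H" using HD(4) by (auto simp: topspace_eq)
  have sub: "prod_topology (subtopology T H) (subtopology T H) = subtopology (prod_topology T T) (H \<times> H)"
    by (simp add: subtopology_Times)
  show ?thesis
  proof
    show "topspace (subtopology T H) = carrier (G\<lparr>carrier := H\<rparr>)" using ts by simp
    show "continuous_map (prod_topology (subtopology T H) (subtopology T H)) (subtopology T H)
        (\<lambda>(x, y). x \<otimes>\<^bsub>G\<lparr>carrier := H\<rparr>\<^esub> y)"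
      unfolding sub using HD(1)
      by (intro continuous_map_into_subtopology)
        (auto simp: subgroup.m_closed intro: continuous_map_from_subtopology[OF continuous_mult])
    have "continuous_map (subtopology T H) (subtopology T H) (m_inv G)"
      using HD(1) by (intro continuous_map_into_subtopology)
        (auto simp: subgroup.m_inv_closed intro: continuous_map_from_subtopology[OF continuous_inv])
    then show "continuous_map (subtopology T H) (subtopology T H) (m_inv (G\<lparr>carrier := H\<rparr>))"
      by (rule continuous_map_eq) (simp add: ts m_inv_consistent[OF HD(1)])
    show "Hausdorff_space (subtopology T H)" using Hausdorff Hausdorff_space_subtopology by blast
    show "locally_compact_space (subtopology T H)"
      using locally_compact_space_closed_subset[OF locally_compact HD(2)] .
    show "\<alpha> \<in> iso (G\<lparr>carrier := H\<rparr>) (G\<lparr>carrier := H\<rparr>)"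
      using HD(3,4) aut_bij by (auto simp: iso_def hom_def bij_betw_def aut_mult subset_iff
          intro: inj_on_subset)
    show "homeomorphic_map (subtopology T H) (subtopology T H) \<alpha>"
      using homeomorphic_map_subtopologies[OF bicontinuous, of H H] HD(3,4) topspace_eq
      by (simp add: Int_absorb1)
    show "limitin (subtopology T H) (\<lambda>n. (\<alpha> ^^ n) x) \<one>\<^bsub>G\<lparr>carrier := H\<rparr>\<^esub> sequentially"
      if "x \<in> carrier (G\<lparr>carrier := H\<rparr>)" for x
    proof -
      have x: "x \<in> H" "x \<in> carrier G" using that HD(4) by auto
      then show ?thesis
        using contractive[OF x(2)] stable_subgroup_pow_iff[OF H x(2)] HD(5) by (simp add: limitin_subtopology)
    qed
  qed
qed

section \<open>Quotients by a closed stable normal subgroup\<close>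

context
  fixes N
  assumes N: "N \<lhd> G" "closedin T N" "\<alpha> ` N = N"
begin

interpretation N: normal N G by (rule N)

abbreviation (input) "quotient_space \<equiv> quotient_topology T (\<lambda>x. N #> x)"

lemma quotient_coset_eq_iff: "x \<in> carrier G \<Longrightarrow> y \<in> carrier G \<Longrightarrow> N #> x = N #> y \<longleftrightarrow> x \<otimes> inv y \<in> N"
  by (rule rcos_eq_iff[OF N.subgroup_axioms])

lemma topspace_quotient_space: "topspace quotient_space = (\<lambda>x. N #> x) ` carrier G"
  by (simp add: topspace_quotient_topology topspace_eq)

lemma quotient_map_quotient_space: "quotient_map T quotient_space (\<lambda>x. N #> x)"
  by (rule quotient_map_quotient_topology)

lemma continuous_map_quotient_space: "continuous_map T quotient_space (\<lambda>x. N #> x)"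
  using quotient_map_quotient_space quotient_imp_continuous_map by blast

text \<open>The saturation of U is NU, a union of left translates of U, since the cosets are right
  cosets Nx. Openness, which is stronger than being a quotient map, is what later gives local
  compactness and a continuous multiplication on the quotient.\<close>

lemma open_map_quotient_space: "open_map T quotient_space (\<lambda>x. N #> x)"
  unfolding open_map_def
proof (intro allI impI)
  fix U assume U: "openin T U"
  have UG: "U \<subseteq> carrier G" by (rule openin_carrier[OF U])
  have "{x \<in> topspace T. N #> x \<in> (\<lambda>x. N #> x) ` U} = (\<Union>n\<in>N. {x \<in> carrier G. n \<otimes> x \<in> U})" (is "?L = ?R")
  proof
    show "?L \<subseteq> ?R"
    proof
      fix x assume "x \<in> ?L"
      then obtain u where u: "x \<in> carrier G" "u \<in> U" "N #> u = N #> x" by (auto simp: topspace_eq)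
      then have uG: "u \<in> carrier G" using UG by auto
      have "u \<otimes> inv x \<in> N" using quotient_coset_eq_iff u uG by blast
      moreover have "(u \<otimes> inv x) \<otimes> x = u" using u uG by (simp add: m_assoc)
      ultimately show "x \<in> ?R" using u by force
    qed
    show "?R \<subseteq> ?L"
    proof
      fix x assume "x \<in> ?R"
      then obtain n where n: "n \<in> N" "x \<in> carrier G" "n \<otimes> x \<in> U" by auto
      have "(n \<otimes> x) \<otimes> inv x \<in> N" using n by (simp add: m_assoc)
      then have "N #> (n \<otimes> x) = N #> x" using quotient_coset_eq_iff n by simp
      then show "x \<in> ?L" using n by (auto simp: topspace_eq intro!: image_eqI[of _ _ "n \<otimes> x"])
    qed
  qed
  moreover have "openin T ?R" using openin_left_translate[OF U] by auto
  ultimately show "openin quotient_space ((\<lambda>x. N #> x) ` U)"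
    using UG by (auto simp: openin_quotient_topology topspace_eq)
qed

text \<open>As N is closed, x y^-1 \<notin> N is an open condition on pairs (x, y). A product
  neighbourhood A x B on which it holds projects to disjoint open sets.\<close>

lemma Hausdorff_quotient_space: "Hausdorff_space quotient_space"
  unfolding Hausdorff_space_def
proof (intro allI impI, elim conjE)
  fix X Y assume XY: "X \<in> topspace quotient_space" "Y \<in> topspace quotient_space" "X \<noteq> Y"
  obtain x y where x: "x \<in> carrier G" "X = N #> x" and y: "y \<in> carrier G" "Y = N #> y"
    using XY by (auto simp: topspace_quotient_space)
  let ?P = "{p \<in> topspace (prod_topology T T). fst p \<otimes> inv (snd p) \<in> topspace T - N}"
  have "openin (prod_topology T T) ?P"
    using N(2) by (intro openin_continuous_map_preimage[of _ T] continuous_map_mult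
        continuous_map_inverse continuous_map_fst continuous_map_snd) auto
  moreover have "(x, y) \<in> ?P" using x y XY(3) quotient_coset_eq_iff by (simp add: topspace_eq)
  ultimately have "\<exists>A B. openin T A \<and> openin T B \<and> x \<in> A \<and> y \<in> B \<and> A \<times> B \<subseteq> ?P"
    by (rule openin_prod_topology_alt[THEN iffD1, rule_format])
  then obtain A B where AB: "openin T A" "openin T B" "x \<in> A" "y \<in> B" "A \<times> B \<subseteq> ?P"
    by (elim exE conjE)
  have "disjnt ((\<lambda>x. N #> x) ` A) ((\<lambda>x. N #> x) ` B)"
  proof -
    have "N #> a \<noteq> N #> b" if "a \<in> A" "b \<in> B" for a b
    proof -
      have "(a, b) \<in> ?P" using AB that by blast
      then show ?thesis using quotient_coset_eq_iff by (simp add: topspace_eq)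
    qed
    then show ?thesis by (auto simp: disjnt_iff)
  qed
  then show "\<exists>U V. openin quotient_space U \<and> openin quotient_space V \<and> X \<in> U \<and> Y \<in> V \<and> disjnt U V"
    using AB x y open_map_quotient_space unfolding open_map_def by blast
qed

lemma factor_aut_coset: "x \<in> carrier G \<Longrightarrow> factor_aut \<alpha> (N #> x) = N #> \<alpha> x"
  by (rule factor_aut_rcoset[OF aut_hom N.subset N(3)])

lemma quotient_contraction_group: "lc_contraction_group (G Mod N) quotient_space (factor_aut \<alpha>)"
proof -
  interpret M: group "G Mod N" by (rule N.factorgroup_is_group)
  have carr: "carrier (G Mod N) = (\<lambda>x. N #> x) ` carrier G" by (rule carrier_FactGroup)
  have inv: "inv\<^bsub>G Mod N\<^esub> (N #> x) = N #> inv x" if "x \<in> carrier G" for x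
    using N.inv_FactGroup N.rcos_inv that carr by auto
  have ne: "\<alpha> x \<otimes> inv (\<alpha> y) \<in> N \<longleftrightarrow> x \<otimes> inv y \<in> N" if "x \<in> carrier G" "y \<in> carrier G" for x y
    using aut_pow_mem_iff[OF N.subset N(3), of "x \<otimes> inv y" 1] that by (simp add: aut_mult aut_inv)
  have onto: "\<alpha> ` carrier G = carrier G" using aut_bij by (simp add: bij_betw_def)
  have img: "factor_aut \<alpha> ` carrier (G Mod N) = carrier (G Mod N)"
  proof -
    have "factor_aut \<alpha> ` carrier (G Mod N) = (\<lambda>x. N #> x) ` \<alpha> ` carrier G"
      unfolding carr image_image by (rule image_cong) (auto simp: factor_aut_coset)
    then show ?thesis by (simp add: onto carr)
  qed
  have inj: "inj_on (factor_aut \<alpha>) (carrier (G Mod N))"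
  proof (rule inj_onI)
    fix X Y assume XY: "X \<in> carrier (G Mod N)" "Y \<in> carrier (G Mod N)" "factor_aut \<alpha> X = factor_aut \<alpha> Y"
    then obtain x y where xy: "x \<in> carrier G" "X = N #> x" "y \<in> carrier G" "Y = N #> y"
      unfolding carr by blast
    then show "X = Y" using XY(3) by (simp add: factor_aut_coset quotient_coset_eq_iff ne)
  qed
  \<comment> \<open>A product of quotient maps need not be a quotient map. Here it is one because
    the coset projection is open, and continuity of the multiplication can then be checked on
    representatives.\<close>
  have q2: "quotient_map (prod_topology T T) (prod_topology quotient_space quotient_space) (\<lambda>(x, y). (N #> x, N #> y))"
  proof (rule continuous_open_imp_quotient_map)
    show "continuous_map (prod_topology T T) (prod_topology quotient_space quotient_space) (\<lambda>(x, y). (N #> x, N #> y))"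
      unfolding continuous_map_prod_top using continuous_map_quotient_space by simp
    show "open_map (prod_topology T T) (prod_topology quotient_space quotient_space) (\<lambda>(x, y). (N #> x, N #> y))"
      unfolding open_map_def
    proof (intro allI impI)
      fix U assume U: "openin (prod_topology T T) U"
      show "openin (prod_topology quotient_space quotient_space) ((\<lambda>(x, y). (N #> x, N #> y)) ` U)"
        unfolding openin_prod_topology_alt
      proof (intro allI impI)
        fix X Y assume "(X, Y) \<in> (\<lambda>(x, y). (N #> x, N #> y)) ` U"
        then obtain x y where xy: "(x, y) \<in> U" "X = N #> x" "Y = N #> y" by auto
        have "\<exists>A B. openin T A \<and> openin T B \<and> x \<in> A \<and> y \<in> B \<and> A \<times> B \<subseteq> U"
          by (rule openin_prod_topology_alt[THEN iffD1, rule_format, OF U xy(1)])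
        then obtain A B where "openin T A" "openin T B" "x \<in> A" "y \<in> B" "A \<times> B \<subseteq> U"
          by (elim exE conjE)
        then show "\<exists>A B. openin quotient_space A \<and> openin quotient_space B \<and> X \<in> A \<and> Y \<in> B \<and>
            A \<times> B \<subseteq> (\<lambda>(x, y). (N #> x, N #> y)) ` U"
          using open_map_quotient_space xy unfolding open_map_def
          by (intro exI[of _ "(\<lambda>x. N #> x) ` A"] exI[of _ "(\<lambda>x. N #> x) ` B"]) auto
      qed
    qed
    show "(\<lambda>(x, y). (N #> x, N #> y)) ` topspace (prod_topology T T) = topspace (prod_topology quotient_space quotient_space)"
      by (auto simp: topspace_quotient_space topspace_eq)
  qed
  show ?thesis
  proof
    show "topspace quotient_space = carrier (G Mod N)" by (simp add: topspace_quotient_space carr)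
    show "continuous_map (prod_topology quotient_space quotient_space) quotient_space (\<lambda>(x, y). x \<otimes>\<^bsub>G Mod N\<^esub> y)"
    proof (rule continuous_compose_quotient_map[OF q2])
      have "continuous_map (prod_topology T T) quotient_space ((\<lambda>x. N #> x) \<circ> (\<lambda>(x, y). x \<otimes> y))"
        using continuous_map_compose[OF continuous_mult continuous_map_quotient_space] .
      then show "continuous_map (prod_topology T T) quotient_space
          ((\<lambda>(x, y). x \<otimes>\<^bsub>G Mod N\<^esub> y) \<circ> (\<lambda>(x, y). (N #> x, N #> y)))"
        by (rule continuous_map_eq) (auto simp: topspace_eq N.rcos_sum)
    qed
    show "continuous_map quotient_space quotient_space (m_inv (G Mod N))"
    proof (rule continuous_compose_quotient_map[OF quotient_map_quotient_space])
      have "continuous_map T quotient_space ((\<lambda>x. N #> x) \<circ> m_inv G)"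
        using continuous_map_compose[OF continuous_inv continuous_map_quotient_space] .
      then show "continuous_map T quotient_space (m_inv (G Mod N) \<circ> (\<lambda>x. N #> x))"
        by (rule continuous_map_eq) (auto simp: topspace_eq inv)
    qed
    show "Hausdorff_space quotient_space" by (rule Hausdorff_quotient_space)
    show "locally_compact_space quotient_space"
      by (rule locally_compact_space_continuous_open_map_image[OF continuous_map_quotient_space open_map_quotient_space _ locally_compact])
        (simp add: topspace_quotient_space topspace_eq)
    show "factor_aut \<alpha> \<in> iso (G Mod N) (G Mod N)"
      unfolding iso_def hom_def bij_betw_def using img inj
      by (auto simp: carr N.rcos_sum factor_aut_coset aut_mult)
    show "homeomorphic_map quotient_space quotient_space (factor_aut \<alpha>)"
    proof (rule bijective_open_imp_homeomorphic_map)
      show "continuous_map quotient_space quotient_space (factor_aut \<alpha>)"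
      proof (rule continuous_compose_quotient_map[OF quotient_map_quotient_space])
        have "continuous_map T quotient_space ((\<lambda>x. N #> x) \<circ> \<alpha>)"
          using continuous_map_compose[OF continuous_aut continuous_map_quotient_space] .
        then show "continuous_map T quotient_space (factor_aut \<alpha> \<circ> (\<lambda>x. N #> x))"
          by (rule continuous_map_eq) (auto simp: topspace_eq factor_aut_coset)
      qed
      show "open_map quotient_space quotient_space (factor_aut \<alpha>)" unfolding open_map_def
      proof (intro allI impI)
        fix U assume U: "openin quotient_space U"
        define V where "V = {x \<in> topspace T. N #> x \<in> U}"
        have "openin T V" using U by (simp add: V_def openin_quotient_topology)
        then have "openin quotient_space ((\<lambda>x. N #> x) ` \<alpha> ` V)"
          using openin_aut_image open_map_quotient_space unfolding open_map_def by blast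
        moreover have "U = (\<lambda>x. N #> x) ` V"
          using U by (auto simp: V_def openin_quotient_topology)
        then have "factor_aut \<alpha> ` U = (\<lambda>x. factor_aut \<alpha> (N #> x)) ` V" by (simp add: image_image)
        then have "factor_aut \<alpha> ` U = (\<lambda>x. N #> x) ` \<alpha> ` V" unfolding image_image
          by (auto simp: V_def topspace_eq factor_aut_coset)
        ultimately show "openin quotient_space (factor_aut \<alpha> ` U)" by simp
      qed
    qed (use img inj in \<open>auto simp: topspace_quotient_space carr\<close>)
    show "limitin quotient_space (\<lambda>n. (factor_aut \<alpha> ^^ n) X) \<one>\<^bsub>G Mod N\<^esub> sequentially"
      if X: "X \<in> carrier (G Mod N)" for X
    proof -
      obtain x where x: "x \<in> carrier G" "X = N #> x" using X carr by auto
      have "(factor_aut \<alpha> ^^ n) X = N #> (\<alpha> ^^ n) x" for n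
        by (induction n) (auto simp: x factor_aut_coset)
      then show ?thesis
        using continuous_map_limit[OF continuous_map_quotient_space contractive[OF x(1)]]
        by (simp add: o_def N.subset)
    qed
  qed
qed

text \<open>Correspondence theorem: images and preimages under the coset projection match the closed
  stable normal subgroups of the quotient with those of G that contain N. Simplicity of a factor
  becomes a maximality condition without cosets.\<close>

lemma simple_quotient_iff:
  "simple_contraction_group (G Mod N) quotient_space (factor_aut \<alpha>) \<longleftrightarrow>
    N \<noteq> carrier G \<and>
    (\<forall>M. M \<lhd> G \<and> closedin T M \<and> \<alpha> ` M = M \<and> N \<subseteq> M \<longrightarrow> M = N \<or> M = carrier G)" (is "?L \<longleftrightarrow> ?R")
proof -
  interpret M: group "G Mod N" by (rule N.factorgroup_is_group)
  have carr: "carrier (G Mod N) = (\<lambda>x. N #> x) ` carrier G" by (rule carrier_FactGroup)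
  have inv: "inv\<^bsub>G Mod N\<^esub> (N #> x) = N #> inv x" if "x \<in> carrier G" for x
    using N.inv_FactGroup N.rcos_inv that carr by auto
  have coset_N: "N #> x = N \<longleftrightarrow> x \<in> N" if "x \<in> carrier G" for x
    using quotient_coset_eq_iff[OF that one_closed] that N.subset by simp
  have triv: "carrier (G Mod N) = {N} \<longleftrightarrow> N = carrier G"
  proof
    assume "carrier (G Mod N) = {N}"
    then have "N #> x = N" if "x \<in> carrier G" for x using that by (auto simp: carr)
    then show "N = carrier G" using coset_N N.subset by blast
  next
    assume "N = carrier G"
    then have "(\<lambda>x. N #> x) ` carrier G = (\<lambda>x. N) ` carrier G"
      using coset_N by (intro image_cong) auto
    then show "carrier (G Mod N) = {N}" using one_closed by (auto simp: carr)
  qed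
  have onto: "\<alpha> ` carrier G = carrier G" using aut_bij by (simp add: bij_betw_def)
  show ?thesis
  proof
    assume L: ?L
    have "M = N \<or> M = carrier G"
      if M: "M \<lhd> G" "closedin T M" "\<alpha> ` M = M" "N \<subseteq> M" for M
    proof -
      interpret MM: normal M G by fact
      define B where "B = (\<lambda>x. N #> x) ` M"
      have mem: "N #> x \<in> B \<longleftrightarrow> x \<in> M" if "x \<in> carrier G" for x
      proof
        assume "N #> x \<in> B"
        then obtain m where m: "m \<in> M" "N #> x = N #> m" by (auto simp: B_def)
        then have "x \<otimes> inv m \<in> M" using quotient_coset_eq_iff that M(4) by auto
        then have "x \<otimes> inv m \<otimes> m \<in> M" using m by blast
        then show "x \<in> M" using that m by (simp add: m_assoc)
      qed (auto simp: B_def)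
      have Bsub: "B \<subseteq> carrier (G Mod N)" using MM.subset by (auto simp: B_def carr)
      have "subgroup B (G Mod N)"
      proof
        show "B \<subseteq> carrier (G Mod N)" by (rule Bsub)
        show "\<one>\<^bsub>G Mod N\<^esub> \<in> B" using mem[of \<one>] N.subset by simp
        show "x \<otimes>\<^bsub>G Mod N\<^esub> y \<in> B" if "x \<in> B" "y \<in> B" for x y
          using that by (auto simp: B_def N.rcos_sum)
        show "inv\<^bsub>G Mod N\<^esub> x \<in> B" if "x \<in> B" for x
          using that by (auto simp: B_def inv)
      qed
      moreover have "x \<otimes>\<^bsub>G Mod N\<^esub> h \<otimes>\<^bsub>G Mod N\<^esub> inv\<^bsub>G Mod N\<^esub> x \<in> B"
        if xh: "x \<in> carrier (G Mod N)" "h \<in> B" for x h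
      proof -
        obtain a m where a: "a \<in> carrier G" "x = N #> a" and m: "m \<in> M" "h = N #> m"
          using xh by (auto simp: carr B_def)
        have "x \<otimes>\<^bsub>G Mod N\<^esub> h \<otimes>\<^bsub>G Mod N\<^esub> inv\<^bsub>G Mod N\<^esub> x = N #> (a \<otimes> m \<otimes> inv a)"
          using a m by (simp add: inv N.rcos_sum)
        then show ?thesis using a m by (auto simp: B_def MM.inv_op_closed2)
      qed
      ultimately have "B \<lhd> G Mod N" by (simp add: M.normal_inv_iff)
      moreover have "closedin quotient_space B"
      proof -
        have "{x \<in> topspace T. N #> x \<in> B} = M" using mem MM.subset by (auto simp: topspace_eq)
        then show ?thesis
          using quotient_map_quotient_space M(2) Bsub unfolding quotient_map_closedin topspace_quotient_space carr by metis
      qed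
      moreover have "factor_aut \<alpha> ` B = B"
      proof -
        have "factor_aut \<alpha> ` B = (\<lambda>x. N #> x) ` \<alpha> ` M"
          unfolding B_def image_image by (rule image_cong) (auto simp: factor_aut_coset)
        then show ?thesis by (simp add: M(3) B_def)
      qed
      ultimately consider "B = {N}" | "B = carrier (G Mod N)"
        using L unfolding simple_contraction_group_def by auto
      then show ?thesis
      proof cases
        case 1
        have "x \<in> N" if x: "x \<in> M" for x
        proof -
          have "N #> x \<in> B" using x by (simp add: B_def)
          then show ?thesis using 1 coset_N[of x] x MM.subset by blast
        qed
        then have "M \<subseteq> N" by blast
        then show ?thesis using M(4) by blast
      next
        case 2
        then have "carrier G \<subseteq> M" using mem by (auto simp: carr)
        then show ?thesis using MM.subset by blast
      qed
    qed
    then show ?R using L triv unfolding simple_contraction_group_def by auto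
  next
    assume R: ?R
    have "B = {N} \<or> B = carrier (G Mod N)"
      if B: "B \<lhd> G Mod N" "closedin quotient_space B" "factor_aut \<alpha> ` B = B" for B
    proof -
      interpret BB: normal B "G Mod N" by fact
      define M where "M = {x \<in> carrier G. N #> x \<in> B}"
      have B_eq: "B = (\<lambda>x. N #> x) ` M" using BB.subset by (auto simp: M_def carr)
      have "subgroup M G"
      proof
        show "\<one> \<in> M" using BB.one_closed N.subset by (simp add: M_def)
        show "x \<otimes> y \<in> M" if "x \<in> M" "y \<in> M" for x y
          using that BB.m_closed[of "N #> x" "N #> y"] by (simp add: M_def N.rcos_sum)
        show "inv x \<in> M" if "x \<in> M" for x
          using that BB.m_inv_closed[of "N #> x"] by (simp add: M_def inv)
      qed (auto simp: M_def)
      moreover have "x \<otimes> h \<otimes> inv x \<in> M" if xh: "x \<in> carrier G" "h \<in> M" for x h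
        using BB.inv_op_closed2[of "N #> x" "N #> h"] xh by (auto simp: M_def inv N.rcos_sum carr)
      ultimately have "M \<lhd> G" by (simp add: normal_inv_iff)
      moreover have "closedin T M"
        using closedin_continuous_map_preimage[OF continuous_map_quotient_space B(2)] by (simp add: M_def topspace_eq)
      moreover have "\<alpha> ` M = M"
      proof
        have "N #> \<alpha> x \<in> B" if "x \<in> M" for x
          using that B(3) factor_aut_coset[of x] by (auto simp: M_def)
        then show "\<alpha> ` M \<subseteq> M" by (auto simp: M_def)
        \<comment> \<open>Stability of B only gives a coset Nz in B with N \<alpha>(z) = N
          \<alpha>(y); stability of N brings this back to Nz = Ny.\<close>
        show "M \<subseteq> \<alpha> ` M"
        proof
          fix x assume x: "x \<in> M"
          then obtain y where y: "y \<in> carrier G" "x = \<alpha> y" using onto by (auto simp: M_def)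
          have "N #> x \<in> factor_aut \<alpha> ` B" using x B(3) by (simp add: M_def)
          then obtain z where z: "z \<in> carrier G" "N #> z \<in> B" "N #> \<alpha> z = N #> \<alpha> y"
            unfolding B_eq y(2) by (auto simp: M_def factor_aut_coset)
          then have "\<alpha> z \<otimes> inv (\<alpha> y) \<in> N" using quotient_coset_eq_iff y by simp
          then have "z \<otimes> inv y \<in> N"
            using aut_pow_mem_iff[OF N.subset N(3), of "z \<otimes> inv y" 1] y z by (simp add: aut_mult aut_inv)
          then have "N #> y \<in> B" using z y quotient_coset_eq_iff by metis
          then show "x \<in> \<alpha> ` M" using y by (auto simp: M_def)
        qed
      qed
      moreover have "N \<subseteq> M"
        using N.rcos_const[OF is_group] N.subset BB.one_closed by (auto simp: M_def)
      ultimately consider "M = N" | "M = carrier G" using R by blast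
      then show ?thesis
      proof cases
        case 1
        then have "B = (\<lambda>x. N) ` N" unfolding B_eq by (simp add: N.rcos_const[OF is_group])
        then show ?thesis using N.one_closed by (simp add: image_constant)
      next
        case 2
        then show ?thesis using B_eq carr by simp
      qed
    qed
    then show ?L
      using R triv quotient_contraction_group unfolding simple_contraction_group_def by auto
  qed
qed

end

end

section \<open>The second isomorphism theorem and the Zassenhaus lemma\<close>

lemma set_multI: "a \<in> A \<Longrightarrow> b \<in> B \<Longrightarrow> a \<otimes>\<^bsub>G\<^esub> b \<in> A <#>\<^bsub>G\<^esub> B"
  by (auto simp: set_mult_def)

lemma (in group) subset_set_mult:
  assumes "A \<subseteq> carrier G" "B \<subseteq> carrier G"
  shows "\<one> \<in> B \<Longrightarrow> A \<subseteq> A <#> B" "\<one> \<in> A \<Longrightarrow> B \<subseteq> A <#> B"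
  using assms set_multI[of _ A \<one> B G] set_multI[of \<one> A _ B G] by (auto simp: subset_iff)

text \<open>Inversion maps the subgroup AB onto itself and turns it into BA.\<close>

lemma (in group) subgroup_set_mult_commute:
  assumes A: "subgroup A G" and B: "subgroup B G" and AB: "subgroup (A <#> B) G"
  shows "A <#> B = B <#> A"
proof -
  have sub: "A \<subseteq> carrier G" "B \<subseteq> carrier G" using A B subgroup.subset by auto
  show ?thesis
  proof
    show "A <#> B \<subseteq> B <#> A"
    proof
      fix x assume x: "x \<in> A <#> B"
      then have "inv x \<in> A <#> B" using AB subgroup.m_inv_closed by metis
      then obtain a b where ab: "a \<in> A" "b \<in> B" "inv x = a \<otimes> b" unfolding set_mult_def by blast
      have "x = inv (inv x)" using x AB subgroup.subset by (metis inv_inv subsetD)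
      also have "\<dots> = inv b \<otimes> inv a" using ab sub by (simp add: inv_mult_group subset_iff)
      finally show "x \<in> B <#> A"
        using ab A B by (simp add: set_multI subgroup.m_inv_closed)
    qed
    show "B <#> A \<subseteq> A <#> B"
    proof
      fix x assume "x \<in> B <#> A"
      then obtain a b where ab: "a \<in> A" "b \<in> B" "x = b \<otimes> a" unfolding set_mult_def by blast
      have "inv a \<otimes> inv b \<in> A <#> B"
        using ab A B by (intro set_multI subgroup.m_inv_closed)
      then have "inv (inv a \<otimes> inv b) \<in> A <#> B" using AB subgroup.m_inv_closed by metis
      then show "x \<in> A <#> B" using ab sub by (simp add: inv_mult_group subset_iff)
    qed
  qed
qed

text \<open>Expresses normality in H through the operations of the ambient group, so that it can be
  compared for different H.\<close>

lemma (in group) subgroup_restrict_normal_iff: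
  assumes H: "subgroup H G"
  shows "N \<lhd> G\<lparr>carrier := H\<rparr> \<longleftrightarrow>
    subgroup N G \<and> N \<subseteq> H \<and> (\<forall>x\<in>H. \<forall>n\<in>N. x \<otimes> n \<otimes> inv x \<in> N)"
proof -
  interpret S: group "G\<lparr>carrier := H\<rparr>" using subgroup_imp_group[OF H] .
  have "subgroup N (G\<lparr>carrier := H\<rparr>) \<longleftrightarrow> subgroup N G \<and> N \<subseteq> H"
    using incl_subgroup[OF H] subgroup_incl[OF _ H] subgroup.subset[of N "G\<lparr>carrier := H\<rparr>"] by auto
  then show ?thesis
    unfolding S.normal_inv_iff using m_inv_consistent[OF H] by auto
qed

context lc_contraction_group
begin

text \<open>A coset depends only on the multiplication, which a change of carrier leaves alone. So a
  factor is literally a quotient of the contraction group on H, and the results on quotients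
  apply.\<close>

lemma factor_as_quotient:
  "factor_group G H N = G\<lparr>carrier := H\<rparr> Mod N"
  "factor_topology G T H N = quotient_topology (subtopology T H) (\<lambda>x. N #>\<^bsub>G\<lparr>carrier := H\<rparr>\<^esub> x)"
  by (simp_all add: factor_group_def factor_topology_def r_coset_def)

lemma factor_contraction_group:
  assumes H: "stable_subgroup H" and N: "stable_subgroup N" "N \<lhd> G\<lparr>carrier := H\<rparr>"
  shows "lc_contraction_group (factor_group G H N) (factor_topology G T H N) (factor_aut \<alpha>)"
proof -
  interpret S: lc_contraction_group "G\<lparr>carrier := H\<rparr>" "subtopology T H" \<alpha>
    by (rule stable_subgroup_contraction_group[OF H])
  have "N \<subseteq> H" using N(2) subgroup_restrict_normal_iff[OF stable_subgroupD(1)[OF H]] by blast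
  then have "closedin (subtopology T H) N"
    using stable_subgroupD(2)[OF N(1)] closedin_subset_topspace by blast
  then show ?thesis
    unfolding factor_as_quotient
    using S.quotient_contraction_group[OF N(2)] stable_subgroupD(3)[OF N(1)] by blast
qed

lemma simple_factor_iff:
  assumes H: "stable_subgroup H" and N: "stable_subgroup N" "N \<lhd> G\<lparr>carrier := H\<rparr>"
  shows "simple_contraction_group (factor_group G H N) (factor_topology G T H N) (factor_aut \<alpha>) \<longleftrightarrow>
    N \<noteq> H \<and> (\<forall>M. stable_subgroup M \<and> M \<lhd> G\<lparr>carrier := H\<rparr> \<and> N \<subseteq> M \<longrightarrow> M = N \<or> M = H)"
proof -
  interpret S: lc_contraction_group "G\<lparr>carrier := H\<rparr>" "subtopology T H" \<alpha>
    by (rule stable_subgroup_contraction_group[OF H])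
  note normal_iff = subgroup_restrict_normal_iff[OF stable_subgroupD(1)[OF H]]
  have closed: "closedin (subtopology T H) M \<longleftrightarrow> closedin T M" if "M \<lhd> G\<lparr>carrier := H\<rparr>" for M
    using that normal_iff[of M] closedin_closed_subtopology[OF stable_subgroupD(2)[OF H]] by simp
  have "stable_subgroup M \<and> M \<lhd> G\<lparr>carrier := H\<rparr> \<and> N \<subseteq> M \<longleftrightarrow>
      M \<lhd> G\<lparr>carrier := H\<rparr> \<and> closedin (subtopology T H) M \<and> \<alpha> ` M = M \<and> N \<subseteq> M" for M
    using closed[of M] normal_iff[of M] unfolding stable_subgroup_def by blast
  then show ?thesis
    unfolding factor_as_quotient
    using S.simple_quotient_iff[OF N(2)] closed[OF N(2)] stable_subgroupD(2,3)[OF N(1)]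
    by (simp del: r_coset_consistent)
qed

text \<open>Each coset of P \<inter> M goes to the coset of M containing it; bijectivity and
  continuity are formal. Openness is where contraction enters, through
  \<open>stable_subgroup_product_neighbourhood\<close>: elements of L = PM near the identity factor
  as cm with c small in P, so a small move in L/M comes from a small move in P.\<close>

lemma second_isomorphism:
  assumes P: "stable_subgroup P" and M: "stable_subgroup M" and L: "stable_subgroup L"
    and L_eq: "L = P <#> M" and nML: "M \<lhd> G\<lparr>carrier := L\<rparr>"
  shows "contraction_group_isomorphic
    (factor_group G P (P \<inter> M)) (factor_topology G T P (P \<inter> M)) (factor_aut \<alpha>)
    (factor_group G L M) (factor_topology G T L M) (factor_aut \<alpha>)"
proof -
  note PD = stable_subgroupD[OF P] and MD = stable_subgroupD[OF M] and LD = stable_subgroupD[OF L]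
  define D where "D = P \<inter> M"
  have D: "stable_subgroup D" unfolding D_def by (rule stable_subgroup_Int[OF P M])
  note DD = stable_subgroupD[OF D]
  have PL: "P \<subseteq> L" unfolding L_eq by (rule subset_set_mult(1)[OF PD(4) MD(4,5)])
  have norm: "x \<otimes> m \<otimes> inv x \<in> M" if "x \<in> L" "m \<in> M" for x m
    using nML that subgroup_restrict_normal_iff[OF LD(1)] by blast
  have DP: "D \<lhd> G\<lparr>carrier := P\<rparr>"
    using norm PL DD(1) PD(1) unfolding subgroup_restrict_normal_iff[OF PD(1)]
    by (auto simp: D_def subgroup.m_closed subgroup.m_inv_closed subsetD)
  \<comment> \<open>The set product with M sends \<open>D #> x\<close> to \<open>M #> x\<close>, so
    no representative has to be chosen.\<close>
  define \<phi> where "\<phi> C = M <#> C" for C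
  have MDM: "M <#> D = M"
  proof
    show "M <#> D \<subseteq> M" using MD(1) by (auto simp: set_mult_def D_def subgroup.m_closed)
    show "M \<subseteq> M <#> D" by (rule subset_set_mult(1)[OF MD(4) DD(4,5)])
  qed
  have \<phi>: "\<phi> (D #> x) = M #> x" if "x \<in> P" for x
    using setmult_rcos_assoc[OF MD(4) DD(4), of x] that PD(4) MDM by (auto simp: \<phi>_def)
  have eqM: "M #> x = M #> y \<longleftrightarrow> x \<otimes> inv y \<in> M" if "x \<in> carrier G" "y \<in> carrier G" for x y
    by (rule rcos_eq_iff[OF MD(1) that])
  have eqD: "D #> x = D #> y \<longleftrightarrow> x \<otimes> inv y \<in> M" if "x \<in> P" "y \<in> P" for x y
  proof -
    have "x \<otimes> inv y \<in> P" using that PD(1) by (simp add: subgroup.m_closed subgroup.m_inv_closed)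
    then show ?thesis using rcos_eq_iff[OF DD(1), of x y] that PD(4) by (auto simp: D_def)
  qed
  have multD: "(D #> x) <#> (D #> y) = D #> (x \<otimes> y)" if "x \<in> P" "y \<in> P" for x y
    using normal.rcos_sum[OF DP, of x y] that by simp
  have multM: "(M #> x) <#> (M #> y) = M #> (x \<otimes> y)" if "x \<in> L" "y \<in> L" for x y
    using normal.rcos_sum[OF nML, of x y] that by simp
  have carrD: "carrier (factor_group G P D) = (\<lambda>x. D #> x) ` P"
    and carrM: "carrier (factor_group G L M) = (\<lambda>x. M #> x) ` L"
    by (simp_all add: factor_group_def carrier_FactGroup)
  have tsD: "topspace (factor_topology G T P D) = (\<lambda>x. D #> x) ` P"
    and tsM: "topspace (factor_topology G T L M) = (\<lambda>x. M #> x) ` L"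
    using topspace_factor_topology carrD carrM PD(4) LD(4) topspace_eq by metis+
  have inj: "inj_on \<phi> ((\<lambda>x. D #> x) ` P)"
  proof (rule inj_onI)
    fix X Y assume "X \<in> (\<lambda>x. D #> x) ` P" "Y \<in> (\<lambda>x. D #> x) ` P" and eq: "\<phi> X = \<phi> Y"
    then obtain x y where xy: "x \<in> P" "X = D #> x" "y \<in> P" "Y = D #> y" by blast
    then have "x \<otimes> inv y \<in> M" using eq \<phi> eqM[of x y] PD(4) by auto
    then show "X = Y" using eqD xy by simp
  qed
  have coset_absorb: "M #> (p \<otimes> m) = M #> p" if "p \<in> P" "m \<in> M" for p m
  proof -
    have "p \<otimes> m \<otimes> inv p \<in> M" using norm that PL by blast
    then show ?thesis using eqM[of "p \<otimes> m" p] that PD(4) MD(4) by auto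
  qed
  have onto: "\<phi> ` (\<lambda>x. D #> x) ` P = (\<lambda>x. M #> x) ` L"
  proof -
    have "\<phi> ` (\<lambda>x. D #> x) ` P = (\<lambda>x. M #> x) ` P" using \<phi> by (auto simp: image_image)
    also have "\<dots> = (\<lambda>x. M #> x) ` L"
    proof
      show "(\<lambda>x. M #> x) ` L \<subseteq> (\<lambda>x. M #> x) ` P"
      proof clarify
        fix x assume "x \<in> L"
        then obtain p m where "p \<in> P" "m \<in> M" "x = p \<otimes> m" unfolding L_eq set_mult_def by blast
        then show "M #> x \<in> (\<lambda>x. M #> x) ` P" using coset_absorb by auto
      qed
    qed (use PL in auto)
    finally show ?thesis .
  qed
  have "\<phi> \<in> iso (factor_group G P D) (factor_group G L M)"
  proof -
    have "\<phi> (X <#> Y) = \<phi> X <#> \<phi> Y" if XY: "X \<in> (\<lambda>x. D #> x) ` P" "Y \<in> (\<lambda>x. D #> x) ` P" for X Y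
    proof -
      obtain x y where xy: "x \<in> P" "X = D #> x" "y \<in> P" "Y = D #> y" using XY by blast
      have "x \<otimes> y \<in> P" using xy PD(1) by (simp add: subgroup.m_closed)
      moreover have "x \<in> L" "y \<in> L" using xy PL by auto
      ultimately show ?thesis using xy by (simp add: \<phi> multD multM)
    qed
    moreover have "\<phi> X \<in> carrier (factor_group G L M)" if "X \<in> (\<lambda>x. D #> x) ` P" for X
      using that onto carrM by blast
    moreover have "bij_betw \<phi> (carrier (factor_group G P D)) (carrier (factor_group G L M))"
      using inj onto by (simp add: bij_betw_def carrD carrM)
    ultimately show ?thesis
      unfolding iso_def hom_def by (simp add: carrD) (simp add: factor_group_def)
  qed
  moreover have "homeomorphic_map (factor_topology G T P D) (factor_topology G T L M) \<phi>"
  proof (rule bijective_open_imp_homeomorphic_map)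
    have qP: "quotient_map (subtopology T P) (factor_topology G T P D) (\<lambda>x. D #> x)"
      and qL: "quotient_map (subtopology T L) (factor_topology G T L M) (\<lambda>x. M #> x)"
      unfolding factor_topology_def by (rule quotient_map_quotient_topology)+
    show "continuous_map (factor_topology G T P D) (factor_topology G T L M) \<phi>"
    proof (rule continuous_compose_quotient_map[OF qP])
      have "continuous_map (subtopology (subtopology T L) P) (factor_topology G T L M) (\<lambda>x. M #> x)"
        by (intro continuous_map_from_subtopology quotient_imp_continuous_map[OF qL])
      then have "continuous_map (subtopology T P) (factor_topology G T L M) (\<lambda>x. M #> x)"
        using PL by (simp add: subtopology_subtopology Int_absorb1)
      then show "continuous_map (subtopology T P) (factor_topology G T L M) (\<phi> \<circ> (\<lambda>x. D #> x))"
        by (rule continuous_map_eq) (use \<phi> in auto)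
    qed
    show "open_map (factor_topology G T P D) (factor_topology G T L M) \<phi>"
      unfolding open_map_def
    proof (intro allI impI)
      fix U assume U: "openin (factor_topology G T P D) U"
      define V where "V = {x \<in> P. D #> x \<in> U}"
      have "topspace (subtopology T P) = P" using PD(4) by (auto simp: topspace_eq)
      then have "openin (subtopology T P) V" and Usub: "U \<subseteq> (\<lambda>x. D #> x) ` P"
        using U by (auto simp: factor_topology_def openin_quotient_topology V_def)
      then obtain V1 where V1: "openin T V1" "V = V1 \<inter> P" by (auto simp: openin_subtopology)
      have U_eq: "U = (\<lambda>x. D #> x) ` V" using Usub by (auto simp: V_def)
      have \<phi>U: "\<phi> ` U = (\<lambda>x. M #> x) ` V" unfolding U_eq image_image
        by (rule image_cong) (auto simp: V_def \<phi>)
      \<comment> \<open>The preimage of \<phi>(U) in L, shown to be open around each of its points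
        y. Below, v in V represents the same coset of M as y.\<close>
      define E where "E = {x \<in> L. M #> x \<in> \<phi> ` U}"
      have "\<exists>W. openin (subtopology T L) W \<and> y \<in> W \<and> W \<subseteq> E" if y: "y \<in> E" for y
      proof -
        obtain v where v: "v \<in> V" "M #> y = M #> v" using y by (auto simp: E_def \<phi>U)
        have yL: "y \<in> L" using y by (simp add: E_def)
        have G: "v \<in> carrier G" "y \<in> carrier G" "v \<in> P" using v y PD(4) LD(4) by (auto simp: V_def E_def)
        \<comment> \<open>This is v^-1 \<open>V1\<close>, so that vc stays in \<open>V1\<close> for
          every c in C.\<close>
        define O1 where "O1 = {x \<in> carrier G. v \<otimes> x \<in> V1}"
        have O1: "openin T O1" "\<one> \<in> O1"
          using openin_left_translate[OF V1(1) G(1)] v V1(2) G by (auto simp: O1_def)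
        obtain C W where CW: "C \<subseteq> O1 \<inter> P" "openin T W" "\<one> \<in> W" "(P <#> M) \<inter> W \<subseteq> C <#> M"
          by (rule stable_subgroup_product_neighbourhood[OF P M O1])
        define W1 where "W1 = {z \<in> carrier G. inv y \<otimes> z \<in> W} \<inter> L"
        have "openin (subtopology T L) W1"
          unfolding W1_def openin_subtopology using openin_left_translate[OF CW(2)] G by blast
        moreover have "y \<in> W1" using CW(3) G yL by (simp add: W1_def)
        moreover have "W1 \<subseteq> E"
        proof
          fix z assume z: "z \<in> W1"
          then have zG: "z \<in> carrier G" and zL: "z \<in> L" by (auto simp: W1_def)
          have "inv y \<otimes> z \<in> L" using yL zL LD(1) by (simp add: subgroup.m_closed subgroup.m_inv_closed)
          then have "inv y \<otimes> z \<in> C <#> M" using CW(4) z unfolding L_eq by (auto simp: W1_def)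
          then obtain c m where cm: "c \<in> C" "m \<in> M" "inv y \<otimes> z = c \<otimes> m"
            unfolding set_mult_def by blast
          have c: "c \<in> P" "c \<in> carrier G" "v \<otimes> c \<in> V1" using cm CW(1) by (auto simp: O1_def)
          have mG: "m \<in> carrier G" and mL: "m \<in> L"
            using cm MD(4) nML subgroup_restrict_normal_iff[OF LD(1)] by auto
          have vc: "v \<otimes> c \<in> P" using G c PD(1) by (simp add: subgroup.m_closed)
          then have vcV: "v \<otimes> c \<in> V" using c V1(2) by blast
          have cmL: "c \<otimes> m \<in> L" using c PL mL LD(1) by (simp add: subgroup.m_closed subsetD)
          \<comment> \<open>Hence Mz = (My)(Mcm) = (Mv)(Mcm) = Mvcm = Mvc, where m is absorbed
            because M is normal in L. As vc lies in V, this puts z in E.\<close>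
          have "z = y \<otimes> (c \<otimes> m)" using cm(3) G zG by (metis inv_cancel_left(1))
          then have "M #> z = (M #> y) <#> (M #> (c \<otimes> m))" using multM[OF yL cmL] by simp
          also have "\<dots> = M #> (v \<otimes> (c \<otimes> m))" using multM[of v "c \<otimes> m"] cmL G PL v(2) by auto
          also have "\<dots> = M #> (v \<otimes> c)"
            using coset_absorb[OF vc cm(2)] G c mG by (simp add: m_assoc)
          finally show "z \<in> E" using zL vcV by (auto simp: E_def \<phi>U)
        qed
        ultimately show ?thesis by blast
      qed
      then have "openin (subtopology T L) E" using openin_subopen by blast
      moreover have "topspace (subtopology T L) = L" using LD(4) by (auto simp: topspace_eq)
      moreover have "\<phi> ` U \<subseteq> (\<lambda>x. M #> x) ` L" using \<phi>U PL by (auto simp: V_def)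
      ultimately show "openin (factor_topology G T L M) (\<phi> ` U)"
        by (simp add: factor_topology_def openin_quotient_topology E_def)
    qed
  qed (use inj onto in \<open>simp_all add: tsD tsM\<close>)
  moreover have "factor_aut \<alpha> (\<phi> X) = \<phi> (factor_aut \<alpha> X)" if X: "X \<in> carrier (factor_group G P D)" for X
  proof -
    obtain x where x: "x \<in> P" "X = D #> x" using X carrD by auto
    have "\<alpha> x \<in> P" using x PD(3) by blast
    then show ?thesis
      using x \<phi> factor_aut_rcoset[OF aut_hom MD(4,3)] factor_aut_rcoset[OF aut_hom DD(4,3)] PD(4)
      by auto
  qed
  ultimately show ?thesis
    unfolding contraction_group_isomorphic_def D_def[symmetric] by blast
qed

text \<open>Normality of \<open>H1\<close> in H makes the product a subgroup; closedness is the
  deeper part and comes from \<open>closedin_stable_product\<close>. This admits Zassenhaus terms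
  into a series of contraction groups.\<close>

lemma stable_subgroup_zassenhaus:
  assumes H: "stable_subgroup H" and H1: "stable_subgroup H1" "H1 \<lhd> G\<lparr>carrier := H\<rparr>"
    and K: "stable_subgroup K"
  shows "stable_subgroup (H1 <#> (H \<inter> K))"
proof -
  note HD = stable_subgroupD[OF H] and H1D = stable_subgroupD[OF H1(1)]
  have HK: "stable_subgroup (H \<inter> K)" by (rule stable_subgroup_Int[OF H K])
  note HKD = stable_subgroupD[OF HK]
  have "subgroup (H \<inter> K) (G\<lparr>carrier := H\<rparr>)" using subgroup_incl[OF HKD(1) HD(1)] by blast
  then have "subgroup (H1 <#> (H \<inter> K)) G"
    using mult_norm_sub_in_sub[OF H1(2) _ HD(1)] incl_subgroup[OF HD(1)] by blast
  moreover have "\<alpha> ` (H1 <#> (H \<inter> K)) = H1 <#> (H \<inter> K)"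
    using set_mult_hom[OF aut_hom H1D(4) HKD(4)] H1D(3) HKD(3) by simp
  ultimately show ?thesis
    using closedin_stable_product[OF H1(1) HK] unfolding stable_subgroup_def by blast
qed

text \<open>Second isomorphism theorem for P = H \<inter> K and M = \<open>H1\<close> (H \<inter>
  \<open>K1\<close>), whose product is L = \<open>H1\<close> (H \<inter> K). Algebra supplies
  normality of M in L (\<open>preliminary2\<close>) and the formula for P \<inter> M
  (\<open>preliminary1\<close>).\<close>

lemma zassenhaus_half:
  assumes H: "stable_subgroup H" and H1: "stable_subgroup H1" "H1 \<lhd> G\<lparr>carrier := H\<rparr>"
    and K: "stable_subgroup K" and K1: "stable_subgroup K1" "K1 \<lhd> G\<lparr>carrier := K\<rparr>"
  shows "contraction_group_isomorphic
    (factor_group G (H \<inter> K) ((H1 \<inter> K) <#> (H \<inter> K1))) (factor_topology G T (H \<inter> K) ((H1 \<inter> K) <#> (H \<inter> K1))) (factor_aut \<alpha>)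
    (factor_group G (H1 <#> (H \<inter> K)) (H1 <#> (H \<inter> K1))) (factor_topology G T (H1 <#> (H \<inter> K)) (H1 <#> (H \<inter> K1))) (factor_aut \<alpha>)"
proof -
  note HD = stable_subgroupD[OF H] and H1D = stable_subgroupD[OF H1(1)]
  note KD = stable_subgroupD[OF K] and K1D = stable_subgroupD[OF K1(1)]
  have K1K: "K1 \<subseteq> K" using K1(2) subgroup_restrict_normal_iff[OF KD(1)] by blast
  define P where "P = H \<inter> K"
  define M where "M = H1 <#> (H \<inter> K1)"
  define L where "L = H1 <#> (H \<inter> K)"
  have P: "stable_subgroup P" unfolding P_def by (rule stable_subgroup_Int[OF H K])
  have M: "stable_subgroup M" unfolding M_def by (rule stable_subgroup_zassenhaus[OF H H1 K1(1)])
  have L: "stable_subgroup L" unfolding L_def by (rule stable_subgroup_zassenhaus[OF H H1 K])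
  note PD = stable_subgroupD[OF P] and MD = stable_subgroupD[OF M] and LD = stable_subgroupD[OF L]
  have nML: "M \<lhd> G\<lparr>carrier := L\<rparr>"
    unfolding M_def L_def by (rule preliminary2[OF HD(1) H1(2) KD(1) K1(2)])
  have "H \<inter> K1 \<subseteq> carrier G" "\<one> \<in> H \<inter> K1" using HD(4,5) K1D(5) by auto
  then have H1M: "H1 \<subseteq> M" unfolding M_def by (rule subset_set_mult(1)[OF H1D(4)])
  have "L = P <#> M"
  proof
    show "L \<subseteq> P <#> M"
    proof
      fix x assume "x \<in> L"
      then obtain h p where hp: "h \<in> H1" "p \<in> P" "x = h \<otimes> p" unfolding L_def P_def set_mult_def by blast
      have G: "h \<in> carrier G" "p \<in> carrier G" using hp H1D(4) PD(4) by auto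
      have "inv p \<in> H" using hp(2) HD(1) by (simp add: P_def subgroup.m_inv_closed)
      then have "inv p \<otimes> h \<otimes> inv (inv p) \<in> H1"
        using hp(1) H1(2) subgroup_restrict_normal_iff[OF HD(1)] by blast
      \<comment> \<open>hp = p (p^-1 h p), and the conjugate lies in \<open>H1\<close>, hence in
        M.\<close>
      moreover have "x = p \<otimes> (inv p \<otimes> h \<otimes> inv (inv p))"
        using hp(3) G by (simp add: m_assoc inv_cancel_left)
      ultimately show "x \<in> P <#> M" using hp(2) H1M unfolding set_mult_def by blast
    qed
    have "P \<subseteq> L"
      unfolding L_def P_def[symmetric] by (rule subset_set_mult(2)[OF H1D(4) PD(4) H1D(5)])
    moreover have "M \<subseteq> L" using nML subgroup_restrict_normal_iff[OF LD(1)] by blast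
    ultimately show "P <#> M \<subseteq> L" using LD(1) unfolding set_mult_def
      by (auto simp: subgroup.m_closed subsetD)
  qed
  then have "contraction_group_isomorphic
    (factor_group G P (P \<inter> M)) (factor_topology G T P (P \<inter> M)) (factor_aut \<alpha>)
    (factor_group G L M) (factor_topology G T L M) (factor_aut \<alpha>)"
    using second_isomorphism[OF P M L _ nML] by blast
  moreover have "P \<inter> M = (H1 \<inter> K) <#> (H \<inter> K1)"
    unfolding P_def M_def by (rule preliminary1[OF HD(1) H1(2) KD(1) K1(2)])
  ultimately show ?thesis by (simp add: P_def M_def L_def)
qed

text \<open>Butterfly argument: both factors are compared with the quotient of H \<inter> K by
  (\<open>H1\<close> \<inter> K)(H \<inter> \<open>K1\<close>), which is symmetric in the two
  pairs.\<close>

lemma zassenhaus_isomorphic: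
  assumes H: "stable_subgroup H" and H1: "stable_subgroup H1" "H1 \<lhd> G\<lparr>carrier := H\<rparr>"
    and K: "stable_subgroup K" and K1: "stable_subgroup K1" "K1 \<lhd> G\<lparr>carrier := K\<rparr>"
  shows "contraction_group_isomorphic
    (factor_group G (H1 <#> (H \<inter> K)) (H1 <#> (H \<inter> K1))) (factor_topology G T (H1 <#> (H \<inter> K)) (H1 <#> (H \<inter> K1))) (factor_aut \<alpha>)
    (factor_group G (K1 <#> (K \<inter> H)) (K1 <#> (K \<inter> H1))) (factor_topology G T (K1 <#> (K \<inter> H)) (K1 <#> (K \<inter> H1))) (factor_aut \<alpha>)"
proof -
  note HD = stable_subgroupD[OF H] and H1D = stable_subgroupD[OF H1(1)]
  note KD = stable_subgroupD[OF K] and K1D = stable_subgroupD[OF K1(1)]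
  let ?D = "(H1 \<inter> K) <#> (H \<inter> K1)"
  have P: "stable_subgroup (H \<inter> K)" by (rule stable_subgroup_Int[OF H K])
  have eq: "(H \<inter> K) \<inter> (H1 <#> (H \<inter> K1)) = ?D"
    by (rule preliminary1[OF HD(1) H1(2) KD(1) K1(2)])
  have D: "stable_subgroup ?D"
    unfolding eq[symmetric]
    by (rule stable_subgroup_Int[OF P stable_subgroup_zassenhaus[OF H H1 K1(1)]])
  \<comment> \<open>Exchanging the pairs reverses the order of this product. Since it is a subgroup,
    the two orders agree.\<close>
  have comm: "(K1 \<inter> H) <#> (K \<inter> H1) = ?D"
    using subgroup_set_mult_commute[of "H1 \<inter> K" "H \<inter> K1"] stable_subgroupD(1)[OF D]
      stable_subgroupD(1)[OF stable_subgroup_Int[OF H1(1) K]]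
      stable_subgroupD(1)[OF stable_subgroup_Int[OF H K1(1)]]
    by (simp add: Int_commute)
  have DP: "?D \<lhd> G\<lparr>carrier := H \<inter> K\<rparr>"
  proof -
    have "x \<otimes> n \<otimes> inv x \<in> H1 <#> (H \<inter> K1)" if "x \<in> H \<inter> K" "n \<in> ?D" for x n
    proof -
      have "x \<in> H1 <#> (H \<inter> K)"
        using that subset_set_mult(2)[OF H1D(4) stable_subgroupD(4)[OF P] H1D(5)] by blast
      then show ?thesis
        using that preliminary2[OF HD(1) H1(2) KD(1) K1(2)] eq
          subgroup_restrict_normal_iff[OF stable_subgroupD(1)[OF stable_subgroup_zassenhaus[OF H H1 K]]]
        by blast
    qed
    moreover have "x \<otimes> n \<otimes> inv x \<in> H \<inter> K" if "x \<in> H \<inter> K" "n \<in> ?D" for x n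
      using that eq stable_subgroupD(1)[OF P] by (metis IntD1 subgroup.m_closed subgroup.m_inv_closed)
    ultimately show ?thesis
      using stable_subgroupD(1)[OF D] eq unfolding subgroup_restrict_normal_iff[OF stable_subgroupD(1)[OF P]]
      by blast
  qed
  \<comment> \<open>Supplies the group structure and the topspace that inverting the first
    isomorphism requires.\<close>
  interpret F: lc_contraction_group "factor_group G (H \<inter> K) ?D" "factor_topology G T (H \<inter> K) ?D" "factor_aut \<alpha>"
    by (rule factor_contraction_group[OF P D DP])
  have L: "stable_subgroup (H1 <#> (H \<inter> K))" by (rule stable_subgroup_zassenhaus[OF H H1 K])
  have "contraction_group_isomorphic
    (factor_group G (H1 <#> (H \<inter> K)) (H1 <#> (H \<inter> K1))) (factor_topology G T (H1 <#> (H \<inter> K)) (H1 <#> (H \<inter> K1))) (factor_aut \<alpha>)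
    (factor_group G (H \<inter> K) ?D) (factor_topology G T (H \<inter> K) ?D) (factor_aut \<alpha>)"
    using zassenhaus_half[OF H H1 K K1]
    by (rule contraction_group_isomorphic_sym)
      (use F.topspace_eq F.is_group topspace_factor_topology[of _ T G] stable_subgroupD(4)[OF L] topspace_eq
        in \<open>auto\<close>)
  moreover have "contraction_group_isomorphic
    (factor_group G (H \<inter> K) ?D) (factor_topology G T (H \<inter> K) ?D) (factor_aut \<alpha>)
    (factor_group G (K1 <#> (K \<inter> H)) (K1 <#> (K \<inter> H1))) (factor_topology G T (K1 <#> (K \<inter> H)) (K1 <#> (K \<inter> H1))) (factor_aut \<alpha>)"
    using zassenhaus_half[OF K K1 H H1] comm by (simp add: Int_commute)
  ultimately show ?thesis by (rule contraction_group_isomorphic_trans)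
qed

end

section \<open>Series\<close>

text \<open>The definitions number factors by j in 1..n with predecessor j - 1; the proofs below
  number them by j < n with successor \<open>Suc j\<close>.\<close>

lemma ball_Suc_iff: "(\<forall>j\<in>{1..n}. P (j - 1) j) \<longleftrightarrow> (\<forall>j<n. P j (Suc j))"
proof -
  have "{1..n} = Suc ` {..<n}" by (simp add: image_Suc_lessThan)
  then show ?thesis by auto
qed

lemma series_refines_trans:
  "series_refines n S m R \<Longrightarrow> series_refines m R l Q \<Longrightarrow> series_refines n S l Q"
  by (auto simp: series_refines_def)

lemma series_isomorphicI:
  assumes \<sigma>: "bij_betw \<sigma> {..<n} {..<n}"
    and iso: "\<And>k. k < n \<Longrightarrow> contraction_group_isomorphic
      (factor_group G (S (Suc k)) (S k)) (factor_topology G T (S (Suc k)) (S k)) (factor_aut \<alpha>)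
      (factor_group G (R (Suc (\<sigma> k))) (R (\<sigma> k))) (factor_topology G T (R (Suc (\<sigma> k))) (R (\<sigma> k)))
      (factor_aut \<alpha>)"
  shows "series_isomorphic G T \<alpha> n S n R"
proof -
  \<comment> \<open>\<sigma> shifted by one. Outside 1..n it is the identity, as
    \<open>permutes\<close> demands.\<close>
  define \<pi> where "\<pi> k = (if k \<in> {1..n} then Suc (\<sigma> (k - 1)) else k)" for k
  have \<pi>_Suc: "\<pi> (Suc k) = Suc (\<sigma> k)" if "k < n" for k using that by (simp add: \<pi>_def)
  have "bij_betw \<pi> (Suc ` {..<n}) (Suc ` {..<n})"
  proof -
    have "bij_betw (\<pi> \<circ> Suc) {..<n} (Suc ` {..<n})"
    proof -
      have "bij_betw (Suc \<circ> \<sigma>) {..<n} (Suc ` {..<n})"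
        by (rule bij_betw_trans[OF \<sigma>]) (simp add: inj_on_imp_bij_betw)
      then show ?thesis by (rule bij_betw_cong[THEN iffD1, rotated]) (simp add: \<pi>_Suc)
    qed
    then show ?thesis
      using bij_betw_comp_iff[of Suc "{..<n}" "Suc ` {..<n}" \<pi> "Suc ` {..<n}"]
      by (simp add: inj_on_imp_bij_betw)
  qed
  then have "\<pi> permutes {1..n}"
    by (intro bij_imp_permutes) (auto simp: image_Suc_lessThan \<pi>_def)
  moreover have "\<forall>j\<in>{1..n}. contraction_group_isomorphic
         (factor_group G (S j) (S (j - 1))) (factor_topology G T (S j) (S (j - 1))) (factor_aut \<alpha>)
         (factor_group G (R (\<pi> j)) (R (\<pi> j - 1))) (factor_topology G T (R (\<pi> j)) (R (\<pi> j - 1)))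
         (factor_aut \<alpha>)"
  proof
    fix j assume "j \<in> {1..n}"
    then obtain k where "k < n" "j = Suc k" by (cases j) auto
    then show "contraction_group_isomorphic
         (factor_group G (S j) (S (j - 1))) (factor_topology G T (S j) (S (j - 1))) (factor_aut \<alpha>)
         (factor_group G (R (\<pi> j)) (R (\<pi> j - 1))) (factor_topology G T (R (\<pi> j)) (R (\<pi> j - 1)))
         (factor_aut \<alpha>)"
      using iso[of k] by (simp add: \<pi>_Suc)
  qed
  ultimately show ?thesis unfolding series_isomorphic_def by blast
qed

section \<open>Existence of composition refinements\<close>

context lc_contraction_group
begin

lemma stable_subgroup_trivial: "stable_subgroup {\<one>}" "stable_subgroup (carrier G)"
proof -
  have "closedin T {\<one>}"
    using Hausdorff one_closed topspace_eq by (metis Hausdorff_imp_t1_space t1_space_closedin_singleton)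
  then show "stable_subgroup {\<one>}"
    using triv_subgroup aut_one by (simp add: stable_subgroup_def)
  have "closedin T (carrier G)" using topspace_eq by (metis closedin_topspace)
  then show "stable_subgroup (carrier G)"
    using aut_bij subgroup_self by (simp add: stable_subgroup_def bij_betw_def)
qed

lemma contraction_series_iff:
  "contraction_series G T \<alpha> n S \<longleftrightarrow>
    S 0 = {\<one>} \<and> S n = carrier G \<and> (\<forall>j\<le>n. stable_subgroup (S j)) \<and>
    (\<forall>j<n. S j \<lhd> G\<lparr>carrier := S (Suc j)\<rparr>)"
  unfolding contraction_series_def
  using ball_Suc_iff[of n "\<lambda>i j. S i \<lhd> G\<lparr>carrier := S j\<rparr>"]
  by (simp add: stable_subgroup_def Ball_def)

lemma contraction_composition_series_iff:
  "contraction_composition_series G T \<alpha> n S \<longleftrightarrow>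
    contraction_series G T \<alpha> n S \<and>
    (\<forall>j<n. simple_contraction_group (factor_group G (S (Suc j)) (S j))
       (factor_topology G T (S (Suc j)) (S j)) (factor_aut \<alpha>))"
  unfolding contraction_composition_series_def
  using ball_Suc_iff[of n "\<lambda>i j. simple_contraction_group (factor_group G (S j) (S i))
       (factor_topology G T (S j) (S i)) (factor_aut \<alpha>)"]
  by simp

lemma contraction_seriesD:
  assumes "contraction_series G T \<alpha> n S"
  shows "S 0 = {\<one>}" "S n = carrier G" "\<And>j. j \<le> n \<Longrightarrow> stable_subgroup (S j)"
    "\<And>j. j < n \<Longrightarrow> S j \<lhd> G\<lparr>carrier := S (Suc j)\<rparr>"
    "\<And>j. j < n \<Longrightarrow> S j \<subseteq> S (Suc j)"
proof -
  show *: "S 0 = {\<one>}" "S n = carrier G" "\<And>j. j \<le> n \<Longrightarrow> stable_subgroup (S j)"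
    "\<And>j. j < n \<Longrightarrow> S j \<lhd> G\<lparr>carrier := S (Suc j)\<rparr>"
    using assms by (auto simp: contraction_series_iff)
  show "S j \<subseteq> S (Suc j)" if "j < n" for j
    using *(4)[OF that] subgroup_restrict_normal_iff[OF stable_subgroupD(1)[OF *(3)[of "Suc j"]]] that
    by auto
qed

text \<open>\<open>series_refines\<close> compares only sets of terms, so a series with repetitions
  deleted still refines the original. Strictness is what lets \<open>stable_chain_bound\<close>
  limit the length.\<close>

lemma strict_refinement:
  assumes "contraction_series G T \<alpha> n S"
  shows "\<exists>n' S'. contraction_series G T \<alpha> n' S' \<and> series_refines n' S' n S \<and> (\<forall>j<n'. S' j \<noteq> S' (Suc j))"
  using assms
proof (induction n arbitrary: S)
  case 0
  then show ?case by (intro exI[of _ 0] exI[of _ S]) (auto simp: series_refines_def)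
next
  case (Suc n)
  note S = contraction_seriesD[OF Suc.prems]
  show ?case
  proof (cases "\<forall>j<Suc n. S j \<noteq> S (Suc j)")
    case True
    then show ?thesis
      using Suc.prems by (intro exI[of _ "Suc n"] exI[of _ S]) (auto simp: series_refines_def)
  next
    case False
    then obtain j where j: "j \<le> n" "S j = S (Suc j)" using less_Suc_eq_le by blast
    \<comment> \<open>Omits the index \<open>Suc j\<close>, whose term is still present as
      \<open>S j\<close>.\<close>
    define Q where "Q k = (if k \<le> j then S k else S (Suc k))" for k
    have "contraction_series G T \<alpha> n Q"
      unfolding contraction_series_iff
    proof (intro conjI allI impI)
      show "Q 0 = {\<one>}" using S(1) by (simp add: Q_def)
      show "Q n = carrier G" using S(2) j by (cases "j = n") (auto simp: Q_def)
      show "stable_subgroup (Q k)" if "k \<le> n" for k using S(3) that by (auto simp: Q_def)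
      show "Q k \<lhd> G\<lparr>carrier := Q (Suc k)\<rparr>" if "k < n" for k
        using S(4)[of k] S(4)[of "Suc k"] that j by (cases "k = j") (auto simp: Q_def)
    qed
    then obtain n' S' where S': "contraction_series G T \<alpha> n' S'" "series_refines n' S' n Q"
        "\<forall>j<n'. S' j \<noteq> S' (Suc j)"
      using Suc.IH by blast
    have "series_refines n Q (Suc n) S"
      unfolding series_refines_def
    proof
      fix X assume "X \<in> S ` {0..Suc n}"
      then obtain k where k: "k \<le> Suc n" "X = S k" by auto
      consider "k \<le> j" | "k = Suc j" | "k > Suc j" by linarith
      then show "X \<in> Q ` {0..n}"
      proof cases
        case 1
        then show ?thesis using k j by (intro image_eqI[of _ _ k]) (auto simp: Q_def)
      next
        case 2
        then show ?thesis using k j by (intro image_eqI[of _ _ j]) (auto simp: Q_def)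
      next
        case 3
        then show ?thesis using k by (intro image_eqI[of _ _ "k - 1"]) (auto simp: Q_def)
      qed
    qed
    then show ?thesis using S' series_refines_trans by blast
  qed
qed

text \<open>Strictness is preserved so that the longer series competes for maximal length in
  \<open>composition_refinement\<close>.\<close>

lemma insert_into_series:
  assumes S: "contraction_series G T \<alpha> n S" and strict: "\<forall>j<n. S j \<noteq> S (Suc j)"
    and j: "j < n" and M: "stable_subgroup M" "M \<lhd> G\<lparr>carrier := S (Suc j)\<rparr>"
    "S j \<subseteq> M" "M \<noteq> S j" "M \<noteq> S (Suc j)"
  shows "\<exists>S'. contraction_series G T \<alpha> (Suc n) S' \<and> series_refines (Suc n) S' n S \<and>
    (\<forall>j<Suc n. S' j \<noteq> S' (Suc j))"
proof -
  note SD = contraction_seriesD[OF S]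
  define Q where "Q k = (if k \<le> j then S k else if k = Suc j then M else S (k - 1))" for k
  have Sj: "stable_subgroup (S (Suc j))" "stable_subgroup (S j)" using SD(3) j by auto
  have "M \<subseteq> S (Suc j)"
    using M(2) subgroup_restrict_normal_iff[OF stable_subgroupD(1)[OF Sj(1)]] by simp
  then have SM: "S j \<lhd> G\<lparr>carrier := M\<rparr>"
    using SD(4)[OF j] M(3) subgroup_restrict_normal_iff[OF stable_subgroupD(1)[OF Sj(1)], of "S j"]
      subgroup_restrict_normal_iff[OF stable_subgroupD(1)[OF M(1)], of "S j"] by auto
  have step: "Q k \<lhd> G\<lparr>carrier := Q (Suc k)\<rparr> \<and> Q k \<noteq> Q (Suc k)" if k: "k < Suc n" for k
  proof -
    consider "k < j" | "k = j" | "k = Suc j" | "k > Suc j" by linarith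
    then show ?thesis
    proof cases
      case 1
      then show ?thesis using SD(4)[of k] strict j by (simp add: Q_def)
    next
      case 2
      then show ?thesis using SM M(4) by (simp add: Q_def)
    next
      case 3
      then show ?thesis using M by (simp add: Q_def)
    next
      case 4
      then obtain l where "k = Suc l" by (cases k) auto
      then show ?thesis using 4 k SD(4)[of l] strict by (simp add: Q_def)
    qed
  qed
  have "contraction_series G T \<alpha> (Suc n) Q"
    unfolding contraction_series_iff
  proof (intro conjI allI impI)
    show "Q 0 = {\<one>}" using SD(1) by (simp add: Q_def)
    show "Q (Suc n) = carrier G" using SD(2) j by (simp add: Q_def)
    show "stable_subgroup (Q k)" if "k \<le> Suc n" for k using SD(3) M(1) that j by (auto simp: Q_def)
  qed (use step in blast)
  moreover have "series_refines (Suc n) Q n S"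
    unfolding series_refines_def
  proof
    fix X assume "X \<in> S ` {0..n}"
    then obtain k where "k \<le> n" "X = S k" by auto
    then show "X \<in> Q ` {0..Suc n}"
      by (intro image_eqI[of _ _ "if k \<le> j then k else Suc k"]) (auto simp: Q_def)
  qed
  ultimately show ?thesis using step by blast
qed

lemma composition_refinement:
  assumes S: "contraction_series G T \<alpha> n S"
  shows "\<exists>n' S'. contraction_composition_series G T \<alpha> n' S' \<and> series_refines n' S' n S"
proof -
  obtain N where N: "\<forall>n S. (\<forall>j\<le>n. stable_subgroup (S j)) \<and> (\<forall>j<n. S j \<subset> S (Suc j)) \<longrightarrow> n \<le> N"
    using stable_chain_bound by metis
  define P where "P k \<longleftrightarrow> (\<exists>S'. contraction_series G T \<alpha> k S' \<and> series_refines k S' n S \<and>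
    (\<forall>j<k. S' j \<noteq> S' (Suc j)))" for k
  have bound: "k \<le> N" if Pk: "P k" for k
  proof -
    obtain S' where S': "contraction_series G T \<alpha> k S'" "\<forall>j<k. S' j \<noteq> S' (Suc j)"
      using Pk P_def by blast
    note S'D = contraction_seriesD[OF S'(1)]
    have "\<forall>j\<le>k. stable_subgroup (S' j)" "\<forall>j<k. S' j \<subset> S' (Suc j)"
      using S'D(3,5) S'(2) by auto
    then show ?thesis using N by blast
  qed
  obtain k0 where "P k0" using strict_refinement[OF S] P_def by blast
  \<comment> \<open>The chain bound makes the maximum exist; \<open>strict_refinement\<close>
    provides a first admissible length.\<close>
  then have "P (Greatest P)" by (rule GreatestI_nat) (use bound in blast)
  then obtain k S' where k: "k = Greatest P" and S': "contraction_series G T \<alpha> k S'"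
      "series_refines k S' n S" "\<forall>j<k. S' j \<noteq> S' (Suc j)"
    using P_def by blast
  note SD = contraction_seriesD[OF S'(1)]
  have "simple_contraction_group (factor_group G (S' (Suc j)) (S' j))
       (factor_topology G T (S' (Suc j)) (S' j)) (factor_aut \<alpha>)" if j: "j < k" for j
  proof (rule ccontr)
    assume "\<not> ?thesis"
    then obtain M where M: "stable_subgroup M" "M \<lhd> G\<lparr>carrier := S' (Suc j)\<rparr>" "S' j \<subseteq> M"
        "M \<noteq> S' j" "M \<noteq> S' (Suc j)"
      using simple_factor_iff[of "S' (Suc j)" "S' j"] SD(3,4) S'(3) j by auto
    obtain S2 where "contraction_series G T \<alpha> (Suc k) S2" "series_refines (Suc k) S2 k S'"
        "\<forall>j<Suc k. S2 j \<noteq> S2 (Suc j)"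
      using insert_into_series[OF S'(1,3) j M] by blast
    then have "P (Suc k)" unfolding P_def using S'(2) series_refines_trans by blast
    then have "Suc k \<le> Greatest P" by (rule Greatest_le_nat) (use bound in blast)
    then show False using k by simp
  qed
  then show ?thesis using S' contraction_composition_series_iff by blast
qed

section \<open>Uniqueness of composition series\<close>

lemma factor_trivial_iff:
  assumes H: "stable_subgroup H" and N: "stable_subgroup N" "N \<subseteq> H"
  shows "N = H \<longleftrightarrow> is_singleton (carrier (factor_group G H N))"
proof -
  note HD = stable_subgroupD[OF H] and ND = stable_subgroupD[OF N(1)]
  have carr: "carrier (factor_group G H N) = (\<lambda>x. N #> x) ` H"
    by (simp add: factor_group_def carrier_FactGroup)
  have coset: "N #> x = N \<longleftrightarrow> x \<in> N" if "x \<in> H" for x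
    using rcos_eq_iff[OF ND(1), of x \<one>] that HD(4) ND(4) by auto
  show ?thesis
  proof
    assume "N = H"
    then have "(\<lambda>x. N #> x) ` H = (\<lambda>x. N) ` H" using coset by (intro image_cong) auto
    then show "is_singleton (carrier (factor_group G H N))"
      using HD(5) carr by (auto simp: image_constant)
  next
    assume "is_singleton (carrier (factor_group G H N))"
    then obtain c where c: "(\<lambda>x. N #> x) ` H = {c}" by (metis carr is_singletonE)
    have "N #> \<one> \<in> (\<lambda>x. N #> x) ` H" using HD(5) by (rule imageI)
    then have "c = N" using c coset[OF HD(5)] ND(5) by simp
    have "x \<in> N" if x: "x \<in> H" for x
    proof -
      have "N #> x \<in> (\<lambda>x. N #> x) ` H" using x by (rule imageI)
      then show ?thesis using c \<open>c = N\<close> coset[OF x] by simp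
    qed
    then show "N = H" using N(2) by blast
  qed
qed

text \<open>Triviality of a factor is a matter of its cardinality, so it passes through any
  bijection. This carries nontrivial steps across the Zassenhaus isomorphisms.\<close>

lemma isomorphic_factor_trivial:
  assumes "contraction_group_isomorphic (factor_group G H N) T1 \<beta> (factor_group G K M) T2 \<gamma>"
    and "stable_subgroup H" "stable_subgroup N" "N \<subseteq> H" "stable_subgroup K" "stable_subgroup M" "M \<subseteq> K"
  shows "N = H \<longleftrightarrow> M = K"
proof -
  obtain f where "bij_betw f (carrier (factor_group G H N)) (carrier (factor_group G K M))"
    using assms(1) unfolding contraction_group_isomorphic_def iso_def by blast
  then have "is_singleton (carrier (factor_group G H N)) \<longleftrightarrow> is_singleton (carrier (factor_group G K M))"
    by (simp add: is_singleton_altdef bij_betw_same_card)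
  then show ?thesis using factor_trivial_iff assms(2-) by simp
qed

text \<open>An intermediate term need not be normal in H, so maximality of N cannot be applied to an
  arbitrary one. It applies to the last term before the chain first reaches H, which is normal in H
  and hence equals N. Monotonicity then makes the chain constant before and after this step.\<close>

lemma simple_factor_unique_jump:
  assumes simple: "simple_contraction_group (factor_group G H N) (factor_topology G T H N) (factor_aut \<alpha>)"
    and HN: "stable_subgroup H" "stable_subgroup N" "N \<lhd> G\<lparr>carrier := H\<rparr>"
    and A: "A 0 = N" "A m = H" "\<And>j. j \<le> m \<Longrightarrow> stable_subgroup (A j)"
      "\<And>j. j < m \<Longrightarrow> A j \<lhd> G\<lparr>carrier := A (Suc j)\<rparr>"
  shows "\<exists>j<m. A j = N \<and> A (Suc j) = H \<and> (\<forall>k<m. A k \<noteq> A (Suc k) \<longrightarrow> k = j)"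
proof -
  have NH: "N \<noteq> H" and max: "\<And>M. stable_subgroup M \<Longrightarrow> M \<lhd> G\<lparr>carrier := H\<rparr> \<Longrightarrow> N \<subseteq> M \<Longrightarrow> M = N \<or> M = H"
    using simple simple_factor_iff[OF HN] by auto
  have inc: "A j \<subseteq> A (Suc j)" if "j < m" for j
    using A(4)[OF that] subgroup_restrict_normal_iff[OF stable_subgroupD(1)[OF A(3)[of "Suc j"]]] that
    by auto
  have mono: "A i \<subseteq> A j" if "i \<le> j" "j \<le> m" for i j
    using that
  proof (induction j rule: dec_induct)
    case (step k)
    then show ?case using inc[of k] by auto
  qed simp
  have "\<exists>j<m. A j \<noteq> H \<and> A (Suc j) = H"
    using ex_least_nat_less[of "\<lambda>j. A j = H" m] A(1,2) NH by auto
  then obtain j where j: "j < m" "A j \<noteq> H" "A (Suc j) = H" by blast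
  have Aj: "A j = N" using max[of "A j"] A(3)[of j] A(4)[of j] mono[of 0 j] j A(1) by auto
  have "k = j" if k: "k < m" "A k \<noteq> A (Suc k)" for k
  proof (rule ccontr)
    assume "k \<noteq> j"
    then consider "Suc k \<le> j" | "Suc j \<le> k" by linarith
    then show False
    proof cases
      case 1
      then show ?thesis using mono[of 0 k] mono[of k "Suc k"] mono[of "Suc k" j] A(1) Aj j k by auto
    next
      case 2
      then show ?thesis using mono[of "Suc j" k] mono[of k "Suc k"] mono[of "Suc k" m] A(2) j k by auto
    qed
  qed
  then show ?thesis using j Aj by blast
qed

text \<open>Row i interpolates from \<open>S i\<close> to \<open>S (Suc i)\<close> along the terms
  of R. Exchanging S with R and i with j gives a second array, whose factor at (j, i) is isomorphic
  to the factor of the first at (i, j).\<close>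

abbreviation (input) zassenhaus_term :: "(nat \<Rightarrow> 'a set) \<Rightarrow> (nat \<Rightarrow> 'a set) \<Rightarrow> nat \<Rightarrow> nat \<Rightarrow> 'a set"
  where "zassenhaus_term S R i j \<equiv> S i <#> (S (Suc i) \<inter> R j)"

lemma zassenhaus_term_properties:
  assumes S: "contraction_series G T \<alpha> n S" and R: "contraction_series G T \<alpha> m R" and i: "i < n"
  shows "zassenhaus_term S R i 0 = S i" "zassenhaus_term S R i m = S (Suc i)"
    "\<And>j. j \<le> m \<Longrightarrow> stable_subgroup (zassenhaus_term S R i j)"
    "\<And>j. j < m \<Longrightarrow> zassenhaus_term S R i j \<lhd> G\<lparr>carrier := zassenhaus_term S R i (Suc j)\<rparr>"
    "\<And>j. j < m \<Longrightarrow> zassenhaus_term S R i j \<subseteq> zassenhaus_term S R i (Suc j)"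
    "\<And>j. j < m \<Longrightarrow> contraction_group_isomorphic
      (factor_group G (zassenhaus_term S R i (Suc j)) (zassenhaus_term S R i j))
      (factor_topology G T (zassenhaus_term S R i (Suc j)) (zassenhaus_term S R i j)) (factor_aut \<alpha>)
      (factor_group G (zassenhaus_term R S j (Suc i)) (zassenhaus_term R S j i))
      (factor_topology G T (zassenhaus_term R S j (Suc i)) (zassenhaus_term R S j i)) (factor_aut \<alpha>)"
proof -
  note SD = contraction_seriesD[OF S] and RD = contraction_seriesD[OF R]
  have Si: "stable_subgroup (S i)" "stable_subgroup (S (Suc i))" "S i \<lhd> G\<lparr>carrier := S (Suc i)\<rparr>" "S i \<subseteq> S (Suc i)"
    using SD(3,4,5) i by auto
  note S1 = stable_subgroupD[OF Si(1)] and S2 = stable_subgroupD[OF Si(2)]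
  have "S (Suc i) \<inter> R 0 = {\<one>}" using RD(1) S2(5) by auto
  moreover have "S i <#> {\<one>} = S i"
    using coset_mult_one[OF S1(4)] by (simp add: r_coset_eq_set_mult)
  ultimately show "zassenhaus_term S R i 0 = S i" by simp
  have "S (Suc i) \<inter> R m = S (Suc i)" using RD(2) S2(4) by auto
  moreover have "S i <#> S (Suc i) = S (Suc i)"
  proof
    show "S i <#> S (Suc i) \<subseteq> S (Suc i)"
      using Si(4) S2(1) by (auto simp: set_mult_def subgroup.m_closed subsetD)
    show "S (Suc i) \<subseteq> S i <#> S (Suc i)" by (rule subset_set_mult(2)[OF S1(4) S2(4) S1(5)])
  qed
  ultimately show "zassenhaus_term S R i m = S (Suc i)" by simp
  show "stable_subgroup (zassenhaus_term S R i j)" if "j \<le> m" for j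
    by (rule stable_subgroup_zassenhaus[OF Si(2,1,3) RD(3)[OF that]])
  show "zassenhaus_term S R i j \<lhd> G\<lparr>carrier := zassenhaus_term S R i (Suc j)\<rparr>" if "j < m" for j
    using preliminary2[OF S2(1) Si(3) stable_subgroupD(1)[OF RD(3)[of "Suc j"]] RD(4)[OF that]] that by simp
  show "zassenhaus_term S R i j \<subseteq> zassenhaus_term S R i (Suc j)" if "j < m" for j
    using RD(5)[OF that] by (intro mono_set_mult) auto
  show "contraction_group_isomorphic
      (factor_group G (zassenhaus_term S R i (Suc j)) (zassenhaus_term S R i j))
      (factor_topology G T (zassenhaus_term S R i (Suc j)) (zassenhaus_term S R i j)) (factor_aut \<alpha>)
      (factor_group G (zassenhaus_term R S j (Suc i)) (zassenhaus_term R S j i))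
      (factor_topology G T (zassenhaus_term R S j (Suc i)) (zassenhaus_term R S j i)) (factor_aut \<alpha>)"
    if "j < m" for j
    using that by (intro zassenhaus_isomorphic Si RD) auto
qed

text \<open>Row i refines a simple factor, so its only nontrivial step is at a single column,
  \<sigma> i.\<close>

lemma composition_series_jumps:
  assumes S: "contraction_composition_series G T \<alpha> n S" and R: "contraction_series G T \<alpha> m R"
  obtains \<sigma> where "\<And>i. i < n \<Longrightarrow> \<sigma> i < m"
    "\<And>i. i < n \<Longrightarrow> zassenhaus_term S R i (\<sigma> i) = S i"
    "\<And>i. i < n \<Longrightarrow> zassenhaus_term S R i (Suc (\<sigma> i)) = S (Suc i)"
    "\<And>i. i < n \<Longrightarrow> S i \<noteq> S (Suc i)"
    "\<And>i j. i < n \<Longrightarrow> j < m \<Longrightarrow> zassenhaus_term S R i j \<noteq> zassenhaus_term S R i (Suc j) \<Longrightarrow> j = \<sigma> i"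
proof -
  have S': "contraction_series G T \<alpha> n S"
    and simple: "\<And>j. j < n \<Longrightarrow> simple_contraction_group (factor_group G (S (Suc j)) (S j))
       (factor_topology G T (S (Suc j)) (S j)) (factor_aut \<alpha>)"
    using S contraction_composition_series_iff by auto
  note SD = contraction_seriesD[OF S']
  have "\<exists>j<m. zassenhaus_term S R i j = S i \<and> zassenhaus_term S R i (Suc j) = S (Suc i) \<and>
      (\<forall>k<m. zassenhaus_term S R i k \<noteq> zassenhaus_term S R i (Suc k) \<longrightarrow> k = j)" if i: "i < n" for i
  proof (rule simple_factor_unique_jump[OF simple[OF i]])
    show "stable_subgroup (S (Suc i))" "stable_subgroup (S i)" "S i \<lhd> G\<lparr>carrier := S (Suc i)\<rparr>"
      using SD(3,4) i by auto
  qed (fact zassenhaus_term_properties(1-4)[OF S' R i])+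
  then obtain \<sigma> where \<sigma>: "\<forall>i<n. \<sigma> i < m \<and> zassenhaus_term S R i (\<sigma> i) = S i \<and>
      zassenhaus_term S R i (Suc (\<sigma> i)) = S (Suc i) \<and>
      (\<forall>k<m. zassenhaus_term S R i k \<noteq> zassenhaus_term S R i (Suc k) \<longrightarrow> k = \<sigma> i)"
    by metis
  have "S i \<noteq> S (Suc i)" if "i < n" for i
    using simple[OF that] simple_factor_iff[of "S (Suc i)" "S i"] SD(3,4) that by auto
  then show thesis using that[of \<sigma>] \<sigma> by blast
qed

text \<open>The step at (i, j) in the array of S is nontrivial exactly when the step at (j, i) in
  the array of R is. As every row of either array has one nontrivial step, \<sigma> and \<tau> are
  mutually inverse, which forces equal lengths. At (i, \<sigma> i) the Zassenhaus isomorphism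
  relates the original factors.\<close>

theorem jordan_hoelder:
  assumes S: "contraction_composition_series G T \<alpha> n S" and R: "contraction_composition_series G T \<alpha> m R"
  shows "series_isomorphic G T \<alpha> n S m R"
proof -
  have S': "contraction_series G T \<alpha> n S" and R': "contraction_series G T \<alpha> m R"
    using S R contraction_composition_series_iff by auto
  obtain \<sigma> where \<sigma>: "\<And>i. i < n \<Longrightarrow> \<sigma> i < m"
    "\<And>i. i < n \<Longrightarrow> zassenhaus_term S R i (\<sigma> i) = S i"
    "\<And>i. i < n \<Longrightarrow> zassenhaus_term S R i (Suc (\<sigma> i)) = S (Suc i)"
    "\<And>i. i < n \<Longrightarrow> S i \<noteq> S (Suc i)"
    "\<And>i j. i < n \<Longrightarrow> j < m \<Longrightarrow> zassenhaus_term S R i j \<noteq> zassenhaus_term S R i (Suc j) \<Longrightarrow> j = \<sigma> i"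
    using composition_series_jumps[OF S R'] by blast
  obtain \<tau> where \<tau>: "\<And>j. j < m \<Longrightarrow> \<tau> j < n"
    "\<And>j. j < m \<Longrightarrow> zassenhaus_term R S j (\<tau> j) = R j"
    "\<And>j. j < m \<Longrightarrow> zassenhaus_term R S j (Suc (\<tau> j)) = R (Suc j)"
    "\<And>j. j < m \<Longrightarrow> R j \<noteq> R (Suc j)"
    "\<And>j i. j < m \<Longrightarrow> i < n \<Longrightarrow> zassenhaus_term R S j i \<noteq> zassenhaus_term R S j (Suc i) \<Longrightarrow> i = \<tau> j"
    using composition_series_jumps[OF R S'] by blast
  have same: "zassenhaus_term S R i j = zassenhaus_term S R i (Suc j) \<longleftrightarrow>
      zassenhaus_term R S j i = zassenhaus_term R S j (Suc i)" if ij: "i < n" "j < m" for i j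
    by (rule isomorphic_factor_trivial[OF zassenhaus_term_properties(6)[OF S' R' ij]])
      (use ij zassenhaus_term_properties(3,5)[OF S' R' ij(1)] zassenhaus_term_properties(3,5)[OF R' S' ij(2)]
        in auto)
  have \<tau>\<sigma>: "\<tau> (\<sigma> i) = i" if i: "i < n" for i
    using \<tau>(5)[OF \<sigma>(1)[OF i] i] same[OF i \<sigma>(1)[OF i]] \<sigma>(2-4)[OF i] by simp
  have \<sigma>\<tau>: "\<sigma> (\<tau> j) = j" if j: "j < m" for j
    using \<sigma>(5)[OF \<tau>(1)[OF j] j] same[OF \<tau>(1)[OF j] j] \<tau>(2-4)[OF j] by simp
  have bij: "bij_betw \<sigma> {..<n} {..<m}"
    by (rule bij_betw_byWitness[of _ \<tau>]) (auto simp: \<tau>\<sigma> \<sigma>\<tau> \<sigma>(1) \<tau>(1))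
  have nm: "n = m" using bij_betw_same_card[OF bij] by simp
  have "series_isomorphic G T \<alpha> n S n R"
  proof (rule series_isomorphicI)
    show "bij_betw \<sigma> {..<n} {..<n}" using bij nm by simp
    fix i assume i: "i < n"
    have "zassenhaus_term R S (\<sigma> i) i = R (\<sigma> i)" "zassenhaus_term R S (\<sigma> i) (Suc i) = R (Suc (\<sigma> i))"
      using \<tau>(2,3)[OF \<sigma>(1)[OF i]] \<tau>\<sigma>[OF i] by simp_all
    then show "contraction_group_isomorphic
      (factor_group G (S (Suc i)) (S i)) (factor_topology G T (S (Suc i)) (S i)) (factor_aut \<alpha>)
      (factor_group G (R (Suc (\<sigma> i))) (R (\<sigma> i))) (factor_topology G T (R (Suc (\<sigma> i))) (R (\<sigma> i)))
      (factor_aut \<alpha>)"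
      using zassenhaus_term_properties(6)[OF S' R' i \<sigma>(1)[OF i]] \<sigma>(2,3)[OF i] by simp
  qed
  then show ?thesis using nm by simp
qed

text \<open>The terms \<open>S i (S (Suc i) \<inter> R j)\<close> listed lexicographically in \<open>(i, j)\<close>. The term
  \<open>j = m\<close> coincides with \<open>j = 0\<close> for \<open>Suc i\<close> and is listed once.\<close>

definition schreier_series :: "nat \<Rightarrow> nat \<Rightarrow> (nat \<Rightarrow> 'a set) \<Rightarrow> (nat \<Rightarrow> 'a set) \<Rightarrow> nat \<Rightarrow> 'a set"
  where "schreier_series n m S R k =
    (if k < n * m then zassenhaus_term S R (k div m) (k mod m) else carrier G)"

text \<open>The formula for \<open>Suc k\<close> also holds at the end of a row, where column m of
  one row equals column 0 of the next, and at the very end, where the default value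
  \<open>carrier G\<close> is \<open>S n\<close>. Thus consecutive terms always come from one
  row.\<close>

lemma schreier_series_properties:
  assumes S: "contraction_series G T \<alpha> n S" and R: "contraction_series G T \<alpha> m R" and pos: "n > 0" "m > 0"
  shows "\<And>k. k < n * m \<Longrightarrow> schreier_series n m S R (Suc k) = zassenhaus_term S R (k div m) (Suc (k mod m))"
    and "contraction_series G T \<alpha> (n * m) (schreier_series n m S R)"
    and "series_refines (n * m) (schreier_series n m S R) n S"
proof -
  note SD = contraction_seriesD[OF S] and RD = contraction_seriesD[OF R]
  note Z = zassenhaus_term_properties[OF S R]
  have div: "k div m < n" "k mod m < m" if "k < n * m" for k
    using that pos by (auto simp: less_mult_imp_div_less)
  show step: "schreier_series n m S R (Suc k) = zassenhaus_term S R (k div m) (Suc (k mod m))"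
    if k: "k < n * m" for k
  proof (cases "Suc (k mod m) = m")
    case True
    have Sk: "Suc k = Suc (k div m) * m"
      using True div_mult_mod_eq[of k m] by (metis add_Suc_right add.commute mult_Suc)
    have "schreier_series n m S R (Suc k) = S (Suc (k div m))"
    proof (cases "Suc (k div m) < n")
      case lt: True
      then have "Suc k < n * m" unfolding Sk using pos by (intro mult_strict_right_mono)
      moreover have "Suc k div m = Suc (k div m)" "Suc k mod m = 0" using Sk pos by simp_all
      ultimately show ?thesis using Z(1)[OF lt] by (simp add: schreier_series_def)
    next
      case False
      then have "Suc (k div m) = n" using div(1)[OF k] by simp
      then show ?thesis using Sk SD(2) by (simp add: schreier_series_def)
    qed
    then show ?thesis using Z(2)[OF div(1)[OF k]] True by simp
  next
    case False
    then have "Suc k div m = k div m" "Suc k mod m = Suc (k mod m)"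
      by (simp_all add: div_Suc mod_Suc)
    moreover from this have "Suc k < n * m"
      using k div(1)[OF k] by (metis Suc_lessI dividend_less_times_div div_mult_self_is_m less_irrefl pos(2))
    ultimately show ?thesis by (simp add: schreier_series_def)
  qed
  show "contraction_series G T \<alpha> (n * m) (schreier_series n m S R)"
    unfolding contraction_series_iff
  proof (intro conjI allI impI)
    show "schreier_series n m S R 0 = {\<one>}"
      using Z(1)[OF pos(1)] SD(1) pos by (simp add: schreier_series_def)
    show "schreier_series n m S R (n * m) = carrier G" by (simp add: schreier_series_def)
    show "stable_subgroup (schreier_series n m S R k)" if "k \<le> n * m" for k
      using Z(3)[OF div(1), of k "k mod m"] div(2)[of k] stable_subgroup_trivial(2)
      by (auto simp: schreier_series_def)
    show "schreier_series n m S R k \<lhd> G\<lparr>carrier := schreier_series n m S R (Suc k)\<rparr>" if k: "k < n * m" for k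
      using Z(4)[OF div[OF k]] step[OF k] k by (simp add: schreier_series_def)
  qed
  show "series_refines (n * m) (schreier_series n m S R) n S"
    unfolding series_refines_def
  proof
    fix X assume "X \<in> S ` {0..n}"
    then obtain i where i: "i \<le> n" "X = S i" by auto
    have "X = schreier_series n m S R (i * m)"
    proof (cases "i = n")
      case True
      then show ?thesis using i SD(2) by (simp add: schreier_series_def)
    next
      case False
      then show ?thesis using i Z(1)[of i] pos by (simp add: schreier_series_def)
    qed
    then show "X \<in> schreier_series n m S R ` {0..n * m}" using i by auto
  qed
qed

theorem schreier_refinement:
  assumes S: "contraction_series G T \<alpha> n S" and R: "contraction_series G T \<alpha> m R"
  shows "\<exists>n' S' m' R'.
    contraction_series G T \<alpha> n' S' \<and> series_refines n' S' n S \<and>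
    contraction_series G T \<alpha> m' R' \<and> series_refines m' R' m R \<and>
    series_isomorphic G T \<alpha> n' S' m' R'"
proof (cases "n = 0 \<or> m = 0")
  case True
  note SD = contraction_seriesD[OF S] and RD = contraction_seriesD[OF R]
  \<comment> \<open>If n = 0 or m = 0 the array is empty, but then G is trivial and the constant
    series of length 0 refines both.\<close>
  have triv: "carrier G = {\<one>}" using True SD(1,2) RD(1,2) by auto
  have S0: "contraction_series G T \<alpha> 0 (\<lambda>_. {\<one>})"
    using triv stable_subgroup_trivial(1) by (simp add: contraction_series_iff)
  have trivial_subgroup: "H = {\<one>}" if "stable_subgroup H" for H
    using stable_subgroupD(4,5)[OF that] triv by auto
  have "series_refines 0 (\<lambda>_. {\<one>}) n S" "series_refines 0 (\<lambda>_. {\<one>}) m R"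
    using trivial_subgroup[OF SD(3)] trivial_subgroup[OF RD(3)]
    unfolding series_refines_def by (intro image_subsetI; simp)+
  moreover have "series_isomorphic G T \<alpha> 0 (\<lambda>_. {\<one>}) 0 (\<lambda>_. {\<one>})"
    by (rule series_isomorphicI[of id]) auto
  ultimately show ?thesis using S0 by blast
next
  case False
  then have pos: "n > 0" "m > 0" by auto
  note SP = schreier_series_properties[OF S R pos] and RP = schreier_series_properties[OF R S pos(2,1)]
  \<comment> \<open>Transposition of the n x m array in lexicographic numbering: i m + j goes to j n
    + i.\<close>
  define \<sigma> where "\<sigma> k = (k mod m) * n + k div m" for k
  have div: "k div m < n" "k mod m < m" if "k < n * m" for k
    using that pos by (auto simp: less_mult_imp_div_less)
  have \<sigma>_div: "\<sigma> k div n = k mod m" "\<sigma> k mod n = k div m" if "k < n * m" for k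
    using div[OF that] pos by (simp_all add: \<sigma>_def)
  have \<sigma>_lt: "\<sigma> k < m * n" if "k < n * m" for k
  proof -
    have "\<sigma> k < (k mod m) * n + n" using div[OF that] by (simp add: \<sigma>_def)
    also have "\<dots> = Suc (k mod m) * n" by simp
    also have "\<dots> \<le> m * n" using div[OF that] by (intro mult_le_mono1) simp
    finally show ?thesis .
  qed
  have "inj_on \<sigma> {..<n * m}"
    by (rule inj_onI) (metis \<sigma>_div div_mult_mod_eq lessThan_iff)
  moreover have "\<sigma> ` {..<n * m} \<subseteq> {..<n * m}" using \<sigma>_lt by (auto simp: mult.commute)
  ultimately have bij: "bij_betw \<sigma> {..<n * m} {..<n * m}"
    by (simp add: bij_betw_def endo_inj_surj)
  have "series_isomorphic G T \<alpha> (n * m) (schreier_series n m S R) (n * m) (schreier_series m n R S)"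
  proof (rule series_isomorphicI[OF bij])
    fix k assume k: "k < n * m"
    have "schreier_series m n R S (\<sigma> k) = zassenhaus_term R S (k mod m) (k div m)"
      using \<sigma>_lt[OF k] \<sigma>_div[OF k] by (simp add: schreier_series_def)
    moreover have "schreier_series m n R S (Suc (\<sigma> k)) = zassenhaus_term R S (k mod m) (Suc (k div m))"
      using RP(1)[OF \<sigma>_lt[OF k]] \<sigma>_div[OF k] by simp
    moreover have "schreier_series n m S R k = zassenhaus_term S R (k div m) (k mod m)"
      using k by (simp add: schreier_series_def)
    ultimately show "contraction_group_isomorphic
      (factor_group G (schreier_series n m S R (Suc k)) (schreier_series n m S R k))
      (factor_topology G T (schreier_series n m S R (Suc k)) (schreier_series n m S R k)) (factor_aut \<alpha>)
      (factor_group G (schreier_series m n R S (Suc (\<sigma> k))) (schreier_series m n R S (\<sigma> k)))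
      (factor_topology G T (schreier_series m n R S (Suc (\<sigma> k))) (schreier_series m n R S (\<sigma> k)))
      (factor_aut \<alpha>)"
      using zassenhaus_term_properties(6)[OF S R div[OF k]] SP(1)[OF k] by simp
  qed
  then show ?thesis using SP(2,3) RP(2,3) by (metis mult.commute)
qed

text \<open>Existence of a composition series is obtained by refining this one.\<close>

lemma trivial_series: "contraction_series G T \<alpha> 1 (\<lambda>k. if k = 0 then {\<one>} else carrier G)"
proof -
  have "{\<one>} \<lhd> G\<lparr>carrier := carrier G\<rparr>"
    unfolding subgroup_restrict_normal_iff[OF subgroup_self] using triv_subgroup by simp
  then show ?thesis using stable_subgroup_trivial by (simp add: contraction_series_iff)
qed

end

theorem theorem4p7:
  fixes G :: "('a, 'b) monoid_scheme" and T :: "'a topology" and \<alpha> :: "'a \<Rightarrow> 'a"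
  assumes "lc_contraction_group G T \<alpha>"
  shows "(\<exists>n S. contraction_composition_series G T \<alpha> n S)
    \<and> (\<forall>n S m R. contraction_series G T \<alpha> n S \<and> contraction_series G T \<alpha> m R \<longrightarrow>
        (\<exists>n' S' m' R'.
          contraction_series G T \<alpha> n' S' \<and> series_refines n' S' n S \<and>
          contraction_series G T \<alpha> m' R' \<and> series_refines m' R' m R \<and>
          series_isomorphic G T \<alpha> n' S' m' R'))
    \<and> (\<forall>n S. contraction_series G T \<alpha> n S \<longrightarrow>
        (\<exists>n' S'. contraction_composition_series G T \<alpha> n' S' \<and> series_refines n' S' n S))
    \<and> (\<forall>n S m R. contraction_composition_series G T \<alpha> n S \<and>
        contraction_composition_series G T \<alpha> m R \<longrightarrow> series_isomorphic G T \<alpha> n S m R)"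
proof -
  interpret lc_contraction_group G T \<alpha> by fact
  show ?thesis
    using composition_refinement[OF trivial_series] schreier_refinement composition_refinement
      jordan_hoelder
    by blast
qed

end
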